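(* Let $p$ be a prime number, $r$ an integer with $r\ge 2$, and $s$ a nonnegative integer. A ring $R$ is a finite local PIR with $\mathrm{char}(R)=p^r$ and has exactly $s$ nontrivial ideals if and only if there exist integers $n\ge 1$, $m\ge 0$, a monic polynomial $g(X)\in\mathbb{Z}_{p^r}[X]$, polynomials $u_i(X),v_j(X)\in\mathbb{Z}_{p^r}[X]\setminus(p,g(X))$ $(1\le i\le n,\ 1\le j\le m)$, and integers $t_1,\dots,t_n,s_1,\dots,s_m$, such that: the reduction $\overline{g}$ of $g$ modulo $p$ is irreducible in $\mathbb{Z}_p[X]$ and $\deg(g)=\deg(\overline{g})$; $\deg(u_i(X))<\deg(g(X))$ for all $i$ and $\deg(v_j(X))<\deg(g(X))$ for all $j$; $$1\le t_1<t_2<\cdots<t_n\le s,\qquad 1\le s_1<s_2<\cdots<s_m\le s,\qquad (r-1)t_1\le s<rt_1;$$ and $R$ is isomorphic to the factor ring $S/Q$, where $S=\mathbb{Z}_{p^r}[X,Y]$ and $$Q=\Big(pY^{s+1-t_1},\ Y^{s+1},\ p-\sum_{i=1}^n u_i(X)Y^{t_i},\ g(X)-\sum_{j=1}^m v_j(X)Y^{s_j}\Big).$$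
   Context: All rings are commutative with identity. A ring is called a PIR if each of its ideals is principal. A nontrivial ideal of $R$ is an ideal different from $0$ and $R$. $\mathbb{Z}_{k}=\mathbb{Z}/k\mathbb{Z}$. The reduction modulo $p$ is the map $\mathbb{Z}_{p^r}[X]\to\mathbb{Z}_{p^r}[X]/p\mathbb{Z}_{p^r}[X]=\mathbb{Z}_p[X]$, and $(p,g(X))$ is the ideal of $\mathbb{Z}_{p^r}[X]$ generated by $p$ and $g(X)$. When $m=0$, the sum over $j$ is empty, i.e. the last generator of $Q$ is $g(X)$. *)

theory Defs
  imports "HOL-Algebra.Ring_Divisibility" "HOL-Algebra.UnivPoly" "HOL-Number_Theory.Residues"
begin

definition ring_char :: "('a, 'b) ring_scheme \<Rightarrow> nat" where
  "ring_char R =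
     (if \<exists>n::nat. 0 < n \<and> [n] \<cdot>\<^bsub>R\<^esub> \<one>\<^bsub>R\<^esub> = \<zero>\<^bsub>R\<^esub>
      then LEAST n::nat. 0 < n \<and> [n] \<cdot>\<^bsub>R\<^esub> \<one>\<^bsub>R\<^esub> = \<zero>\<^bsub>R\<^esub> else 0)"

definition is_local_ring :: "('a, 'b) ring_scheme \<Rightarrow> bool" where
  "is_local_ring R \<longleftrightarrow> cring R \<and> (\<exists>!M. maximalideal M R)"

text \<open>A PIR may have zero divisors, unlike the library's \<open>principal_domain\<close>.\<close>

definition is_PIR :: "('a, 'b) ring_scheme \<Rightarrow> bool" where
  "is_PIR R \<longleftrightarrow> cring R \<and> (\<forall>I. ideal I R \<longrightarrow> principalideal I R)"

definition nontrivial_ideals :: "('a, 'b) ring_scheme \<Rightarrow> 'a set set" where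
  "nontrivial_ideals R = {I. ideal I R \<and> I \<noteq> {\<zero>\<^bsub>R\<^esub>} \<and> I \<noteq> carrier R}"

text \<open>
  The ring of polynomials in \<open>X, Y\<close> is the ring of polynomials in \<open>Y\<close> over the ring of
  polynomials in \<open>X\<close>: the element \<open>a(X) Y^i\<close> is \<open>monom (ZXY k) a i\<close>, and \<open>a(X)\<close> itself
  is \<open>monom (ZXY k) a 0\<close>.  An integer \<open>c\<close>, viewed in a ring, is the multiple \<open>[c]\<cdot>\<one>\<close> of its unit.
\<close>

abbreviation ZX :: "nat \<Rightarrow> (int, nat \<Rightarrow> int) up_ring" where
  "ZX k \<equiv> UP (residue_ring (int k))"

abbreviation ZXY :: "nat \<Rightarrow> (nat \<Rightarrow> int, nat \<Rightarrow> nat \<Rightarrow> int) up_ring" where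
  "ZXY k \<equiv> UP (ZX k)"

abbreviation degX :: "nat \<Rightarrow> (nat \<Rightarrow> int) \<Rightarrow> nat" where
  "degX k f \<equiv> deg (residue_ring (int k)) f"

definition monicX :: "nat \<Rightarrow> (nat \<Rightarrow> int) \<Rightarrow> bool" where
  "monicX k f \<longleftrightarrow> coeff (ZX k) f (degX k f) = \<one>\<^bsub>residue_ring (int k)\<^esub>"

text \<open>
  Coefficientwise reduction \<open>ZX k \<rightarrow> ZX p\<close> for \<open>p\<close> dividing \<open>k\<close>.  Elements of \<open>UP\<close> are
  coefficient functions, and residue classes are represented by their least nonnegative integers.
\<close>

definition reduce_mod :: "nat \<Rightarrow> (nat \<Rightarrow> int) \<Rightarrow> nat \<Rightarrow> int" where
  "reduce_mod p f = (\<lambda>i. f i mod int p)"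

definition ideal_pg :: "nat \<Rightarrow> nat \<Rightarrow> (nat \<Rightarrow> int) \<Rightarrow> (nat \<Rightarrow> int) set" where
  "ideal_pg p r g = Idl\<^bsub>ZX (p ^ r)\<^esub> {[p] \<cdot>\<^bsub>ZX (p ^ r)\<^esub> \<one>\<^bsub>ZX (p ^ r)\<^esub>, g}"

definition ideal_Q ::
  "nat \<Rightarrow> nat \<Rightarrow> nat \<Rightarrow> nat \<Rightarrow> nat \<Rightarrow> (nat \<Rightarrow> int) \<Rightarrow> (nat \<Rightarrow> nat \<Rightarrow> int) \<Rightarrow> (nat \<Rightarrow> nat \<Rightarrow> int)
    \<Rightarrow> (nat \<Rightarrow> nat) \<Rightarrow> (nat \<Rightarrow> nat) \<Rightarrow> (nat \<Rightarrow> nat \<Rightarrow> int) set" where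
  "ideal_Q p r s n m g u v t e =
     (let A = ZX (p ^ r); S = ZXY (p ^ r) in
      Idl\<^bsub>S\<^esub> {[p] \<cdot>\<^bsub>S\<^esub> monom S \<one>\<^bsub>A\<^esub> (s + 1 - t 1),
             monom S \<one>\<^bsub>A\<^esub> (s + 1),
             [p] \<cdot>\<^bsub>S\<^esub> \<one>\<^bsub>S\<^esub> \<ominus>\<^bsub>S\<^esub> (\<Oplus>\<^bsub>S\<^esub>i\<in>{1..n}. monom S (u i) (t i)),
             monom S g 0 \<ominus>\<^bsub>S\<^esub> (\<Oplus>\<^bsub>S\<^esub>j\<in>{1..m}. monom S (v j) (e j))})"

end

theory Submission
  imports Defs "HOL-Algebra.QuotRing" "HOL-Algebra.Multiplicative_Group"
    "HOL-Computational_Algebra.Polynomial_Factorial" "HOL-Library.Infinite_Set"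
begin

text \<open>
A commutative ring \<open>R\<close> is a finite local principal ideal ring with \<open>s\<close> nontrivial ideals iff it is
finite and has an element \<open>y\<close> with \<open>y\<^sup>s\<^sup>+\<^sup>1 = 0 \<noteq> y\<^sup>s\<close> such that every nonunit is a multiple of \<open>y\<close>;
the ideals are then the powers of \<open>(y)\<close> (\<open>finite_local_PIR_iff_chain_gen\<close>).  Moreover \<open>R\<close> is
isomorphic to \<open>S/Q\<close> iff some surjection \<open>\<Phi>\<close> from \<open>\<int>[X][Y]\<close> onto \<open>R\<close> has as kernel the ideal generated by
\<open>p\<^sup>r\<close> and integer lifts of the generators of \<open>Q\<close> (\<open>iso_quotient_iff\<close>, \<open>redXY_in_ideal_Q_iff\<close>).
Thus the theorem compares two kinds of ideals of \<open>\<int>[X][Y]\<close>.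

Let \<open>Q\<close> be given by a presentation.  Modulo \<open>Q\<close> both \<open>p\<close> and \<open>g\<close> are multiples of the nilpotent element
\<open>Y\<close>, and dividing by \<open>Y\<close> leaves the finite field \<open>\<int>[X]/(p, g)\<close>.  Hence the quotient is finite, an
element is a unit or a multiple of \<open>Y\<close>, and \<open>p\<close> is a unit times \<open>Y\<close> to the power \<open>t\<^sub>1\<close>, which together
with the bounds on \<open>t\<^sub>1\<close> gives the characteristic.  What needs an argument is that \<open>Y\<^sup>s\<close> does not vanish
(\<open>Y_power_notin\<close>).  The relations \<open>h = p - \<Sum>i. u i Y^(t i)\<close> and \<open>f = g - \<Sum>j. v j Y^(e j)\<close> turn the remaining
generators into multiples of \<open>Y\<^sup>s\<^sup>+\<^sup>1\<close>, so \<open>Y\<^sup>s (1 - Y c)\<close> would lie in \<open>(h, f)\<close>.  As \<open>p, g\<close> is a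
regular sequence in \<open>\<int>[X]\<close>, \<open>Y\<close> is a nonzerodivisor modulo \<open>(h, f)\<close> (\<open>regular_pair_commute\<close>), and
\<open>1 - Y c \<in> (h, f)\<close> is impossible because \<open>1\<close> does not lie in \<open>(p, g)\<close>.

Conversely let \<open>R\<close> be a finite chain ring with uniformizer \<open>y\<close>, and let \<open>x\<close> lift a generator of the
multiplicative group of the residue field.  Then \<open>x\<close> and \<open>y\<close> generate \<open>R\<close> (\<open>presenting_hom\<close>).  Take \<open>g\<close>
monic of least degree such that \<open>g(x)\<close> is a multiple of \<open>y\<close>.  Every element of \<open>R\<close> is a sum of terms
\<open>w\<^sub>i(x) y\<^sup>i\<close>, where \<open>i \<le> s\<close>, with digits \<open>w\<^sub>i\<close>, polynomials of degree less than that of \<open>g\<close> and with coefficients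
between \<open>0\<close> and \<open>p - 1\<close>; such an expansion of \<open>0\<close> is trivial.  The expansions of \<open>p\<close> and \<open>g(x)\<close> are
the desired relations, and they suffice, since modulo them every polynomial reduces to a digit
expansion (\<open>presentation\<close>).
\<close>

section \<open>Homomorphisms from type-class rings\<close>

text \<open>The relations of a presentation are polynomial identities with integer coefficients, and such
identities are handled most easily in the polynomial ring of the type class.  The locale describes
a homomorphism from a type-class ring into a ring given by a record, so that computations on the
type-class side can be transported to carriers.\<close>

locale class_ring_hom = cring R for R (structure) +
  fixes f :: "'c::comm_ring_1 \<Rightarrow> 'a"
  assumes closed [simp, intro]: "f a \<in> carrier R"
    and hom_one [simp]: "f 1 = \<one>"
    and hom_add: "f (a + b) = f a \<oplus> f b"
    and hom_mult: "f (a * b) = f a \<otimes> f b"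
begin

lemma hom_zero [simp]: "f 0 = \<zero>"
  by (metis hom_add add.l_cancel_one' closed add_0)

lemma hom_uminus: "f (- a) = \<ominus> f a"
  using hom_add[of "- a" a] by (simp add: minus_equality[symmetric])

lemma hom_diff: "f (a - b) = f a \<ominus> f b"
  by (metis hom_add hom_uminus diff_conv_add_uminus a_minus_def)

lemma hom_power: "f (a ^ n) = f a [^] n"
  by (induction n) (auto simp: hom_mult m_comm)

lemma hom_of_nat: "f (of_nat n) = [n] \<cdot> \<one>"
  by (induction n) (auto simp: hom_add a_comm)

lemma hom_sum: "finite A \<Longrightarrow> f (sum g A) = (\<Oplus>i\<in>A. f (g i))"
  by (induction A rule: finite_induct) (auto simp: hom_add finsum_insert Pi_def)

lemma hom_of_nat_mult: "f (of_nat n * a) = [n] \<cdot> f a"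
  by (simp add: hom_mult hom_of_nat add_pow_ldistr)

lemma diff_kernel_iff: "f (a - b) = \<zero> \<longleftrightarrow> f a = f b"
  by (simp add: hom_diff r_right_minus_eq)

end

text \<open>Ideals of a type-class ring are kept as plain sets, so that no carrier conditions arise.\<close>

definition class_ideal :: "'c::comm_ring_1 set \<Rightarrow> bool" where
  "class_ideal I \<longleftrightarrow> 0 \<in> I \<and> (\<forall>a\<in>I. \<forall>b\<in>I. a + b \<in> I) \<and> (\<forall>a\<in>I. \<forall>c. c * a \<in> I)"

lemma class_idealD:
  assumes "class_ideal I"
  shows "0 \<in> I" "a \<in> I \<Longrightarrow> b \<in> I \<Longrightarrow> a + b \<in> I" "a \<in> I \<Longrightarrow> c * a \<in> I"
    "a \<in> I \<Longrightarrow> a * c \<in> I" "a \<in> I \<Longrightarrow> - a \<in> I" "a \<in> I \<Longrightarrow> b \<in> I \<Longrightarrow> a - b \<in> I"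
proof -
  show 1: "0 \<in> I" "a \<in> I \<Longrightarrow> b \<in> I \<Longrightarrow> a + b \<in> I" "a \<in> I \<Longrightarrow> c * a \<in> I" for a b c
    using assms by (auto simp: class_ideal_def)
  show "a \<in> I \<Longrightarrow> a * c \<in> I" using 1(3)[of a c] by (simp add: mult.commute)
  show 2: "a \<in> I \<Longrightarrow> - a \<in> I" for a using 1(3)[of a "-1"] by simp
  show "a \<in> I \<Longrightarrow> b \<in> I \<Longrightarrow> a - b \<in> I" using 1(2)[of a "-b"] 2[of b] by simp
qed

fun ideal_of :: "'c::comm_ring_1 list \<Rightarrow> 'c set" where
  "ideal_of [] = {0}"
| "ideal_of (a # as) = {c * a + z | c z. z \<in> ideal_of as}"

lemma class_ideal_ideal_of: "class_ideal (ideal_of as)"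
proof (induction as)
  case Nil
  then show ?case by (auto simp: class_ideal_def)
next
  case (Cons a as)
  note I = class_idealD[OF Cons]
  show ?case unfolding class_ideal_def
  proof (intro conjI ballI allI)
    show "0 \<in> ideal_of (a # as)" using I(1) by (auto intro!: exI[of _ 0])
  next
    fix x y assume "x \<in> ideal_of (a # as)" "y \<in> ideal_of (a # as)"
    then obtain c z c' z' where "x = c * a + z" "z \<in> ideal_of as" "y = c' * a + z'" "z' \<in> ideal_of as"
      by auto
    then have "x + y = (c + c') * a + (z + z')" "z + z' \<in> ideal_of as"
      using I by (auto simp: algebra_simps)
    then show "x + y \<in> ideal_of (a # as)" by auto
  next
    fix x d assume "x \<in> ideal_of (a # as)"
    then obtain c z where "x = c * a + z" "z \<in> ideal_of as" by auto
    then have "d * x = (d * c) * a + d * z" "d * z \<in> ideal_of as"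
      using I(3)[of z d] by (auto simp: algebra_simps)
    then show "d * x \<in> ideal_of (a # as)" by auto
  qed
qed

lemma generators_in_ideal_of: "set as \<subseteq> ideal_of as"
proof (induction as)
  case (Cons a as)
  note I = class_idealD[OF class_ideal_ideal_of]
  have "a \<in> ideal_of (a # as)" using I(1)[of as] unfolding ideal_of.simps
    by (intro CollectI exI[of _ "1::'a"] exI[of _ "0::'a"] conjI) simp_all
  moreover have "z \<in> ideal_of (a # as)" if "z \<in> ideal_of as" for z
    using that unfolding ideal_of.simps by (intro CollectI exI[of _ "0::'a"] exI[of _ z]) simp
  ultimately show ?case using Cons by (auto simp del: ideal_of.simps)
qed simp

lemma ideal_of_minimal: "class_ideal I \<Longrightarrow> set as \<subseteq> I \<Longrightarrow> ideal_of as \<subseteq> I"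
  by (induction as) (auto intro: class_idealD)

lemma ideal_of_pair: "ideal_of [a, b] = {c * a + d * b | c d. True}"
  by auto

declare ideal_of.simps(2) [simp del]

context class_ring_hom
begin

lemma class_ideal_kernel: "class_ideal {a. f a = \<zero>}"
  by (auto simp: class_ideal_def hom_add hom_mult)

text \<open>
A surjection identifies the ideals of its target with the ideals of its source that contain the
kernel, and this identification respects generators.  It replaces membership in a generated ideal
of residue-class polynomials by an explicit linear combination of integer polynomials.
\<close>

lemma Idl_image:
  assumes surj: "range f = carrier R" and ker: "\<And>a. f a = \<zero> \<Longrightarrow> a \<in> ideal_of as"
  shows "f a \<in> Idl (f ` set as) \<longleftrightarrow> a \<in> ideal_of as"
proof -
  let ?J = "ideal_of as"
  note J = class_idealD[OF class_ideal_ideal_of[of as]]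
  have id: "ideal (f ` ?J) R"
  proof (rule idealI)
    show "subgroup (f ` ?J) (add_monoid R)"
    proof
      show "f ` ?J \<subseteq> carrier (add_monoid R)" by auto
      show "\<one>\<^bsub>add_monoid R\<^esub> \<in> f ` ?J" using J(1) hom_zero by (force intro!: image_eqI[of _ _ 0])
      show "x \<otimes>\<^bsub>add_monoid R\<^esub> y \<in> f ` ?J" if xy: "x \<in> f ` ?J" "y \<in> f ` ?J" for x y
      proof -
        obtain a b where "x = f a" "a \<in> ?J" "y = f b" "b \<in> ?J" using xy by auto
        then show ?thesis using J(2)[of a b] by (auto simp: hom_add[symmetric])
      qed
      show "inv\<^bsub>add_monoid R\<^esub> x \<in> f ` ?J" if x: "x \<in> f ` ?J" for x
      proof -
        obtain a where "x = f a" "a \<in> ?J" using x by auto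
        then show ?thesis using J(5)[of a]
          by (auto simp: hom_uminus a_inv_def[symmetric] intro!: image_eqI[of _ _ "-a"])
      qed
    qed
    show "x \<otimes> a \<in> f ` ?J" "a \<otimes> x \<in> f ` ?J" if ax: "a \<in> f ` ?J" "x \<in> carrier R" for a x
    proof -
      obtain a' x' where "a = f a'" "x = f x'" "a' \<in> ?J" using ax surj by (metis imageE)
      then show "x \<otimes> a \<in> f ` ?J" "a \<otimes> x \<in> f ` ?J"
        using J(3,4)[of a' x'] by (auto simp: hom_mult[symmetric])
    qed
  qed (rule ring_axioms)
  show ?thesis
  proof
    assume "f a \<in> Idl (f ` set as)"
    moreover have "Idl (f ` set as) \<subseteq> f ` ?J"
      by (intro genideal_minimal[OF id] image_mono generators_in_ideal_of)
    ultimately obtain b where b: "f a = f b" "b \<in> ?J" by auto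
    then have "a - b \<in> ?J" using ker diff_kernel_iff by auto
    then show "a \<in> ?J" using J(2)[of "a - b" b] b by simp
  next
    assume a: "a \<in> ?J"
    interpret I: ideal "Idl (f ` set as)" R by (rule genideal_ideal) auto
    have "class_ideal {a. f a \<in> Idl (f ` set as)}"
      by (auto simp: class_ideal_def hom_add hom_mult I.I_l_closed)
    moreover have "set as \<subseteq> {a. f a \<in> Idl (f ` set as)}"
      using genideal_self[of "f ` set as"] by auto
    ultimately show "f a \<in> Idl (f ` set as)" using a ideal_of_minimal by blast
  qed
qed

text \<open>Evaluation at \<open>x\<close> of a polynomial whose coefficients are read in \<open>R\<close> through \<open>f\<close>, by Horner's scheme.
Horner's scheme makes the homomorphism property a plain induction on the coefficient list.  Applied
twice, it evaluates elements of \<open>\<int>[X][Y]\<close> at a pair of elements of \<open>R\<close>.\<close>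

definition peval :: "'a \<Rightarrow> 'c poly \<Rightarrow> 'a" where
  "peval x P = fold_coeffs (\<lambda>a r. f a \<oplus> x \<otimes> r) P \<zero>"

lemma peval_pCons: "x \<in> carrier R \<Longrightarrow> peval x (pCons a P) = f a \<oplus> x \<otimes> peval x P"
  unfolding peval_def by (cases "P = 0"; cases "a = 0") auto

lemma peval_0 [simp]: "peval x 0 = \<zero>"
  by (simp add: peval_def)

lemma peval_closed [simp, intro]: "x \<in> carrier R \<Longrightarrow> peval x P \<in> carrier R"
  by (induction P) (auto simp: peval_pCons)

lemma peval_const: "x \<in> carrier R \<Longrightarrow> peval x [:a:] = f a"
  by (simp add: peval_pCons)

lemma peval_add:
  assumes x: "x \<in> carrier R" shows "peval x (P + Q) = peval x P \<oplus> peval x Q"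
proof (induction P Q rule: poly_induct2)
  case (pCons a P b Q)
  then show ?case using x by (simp add: peval_pCons hom_add r_distr a_ac)
qed simp

lemma peval_smult: "x \<in> carrier R \<Longrightarrow> peval x (smult a P) = f a \<otimes> peval x P"
  by (induction P) (auto simp: peval_pCons hom_mult r_distr m_ac)

lemma peval_hom:
  assumes x: "x \<in> carrier R" shows "class_ring_hom R (peval x)"
proof
  show "peval x (P * Q) = peval x P \<otimes> peval x Q" for P Q
    by (induction P) (use x in \<open>auto simp: peval_add peval_smult peval_pCons l_distr m_assoc\<close>)
qed (use x in \<open>auto simp: peval_add one_pCons peval_const\<close>)

end

lemma (in cring) class_ring_hom_of_int: "class_ring_hom R (\<lambda>n::int. [n] \<cdot> \<one>)"
proof
  show "[(a * b)] \<cdot> \<one> = [a] \<cdot> \<one> \<otimes> [b] \<cdot> \<one>" for a b :: int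
    by (simp add: add_pow_ldistr_int add.int_pow_pow mult.commute)
qed (auto simp: add.int_pow_mult)

context class_ring_hom
begin

text \<open>The two representations of polynomials meet here: applying \<open>f\<close> to every coefficient is a
homomorphism from type-class polynomials to the polynomial ring \<open>UP R\<close>, and it inherits
surjectivity from \<open>f\<close>.\<close>

definition map_up :: "'c poly \<Rightarrow> nat \<Rightarrow> 'a" where
  "map_up P = (\<lambda>i. f (coeff P i))"

lemma map_up_closed: "map_up P \<in> up R"
  by (auto simp: map_up_def up_def bound_def intro!: exI[of _ "degree P"] simp: coeff_eq_0)

lemma map_up_hom: "class_ring_hom (UP R) map_up"
proof -
  interpret U: UP_cring R "UP R" by unfold_locales simp
  interpret UC: cring "UP R" by (rule U.UP_cring)
  show ?thesis
  proof
    show "map_up a \<in> carrier (UP R)" for a using map_up_closed by (simp add: UP_def)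
    show "map_up 1 = \<one>\<^bsub>UP R\<^esub>" by (auto simp: map_up_def UP_def fun_eq_iff)
    show "map_up (a + b) = map_up a \<oplus>\<^bsub>UP R\<^esub> map_up b" for a b
      using map_up_closed by (auto simp: map_up_def UP_def fun_eq_iff hom_add)
    show "map_up (a * b) = map_up a \<otimes>\<^bsub>UP R\<^esub> map_up b" for a b
      using map_up_closed by (auto simp: map_up_def UP_def fun_eq_iff coeff_mult hom_sum hom_mult)
  qed
qed

lemma map_up_surj:
  assumes surj: "range f = carrier R"
  shows "range map_up = carrier (UP R)"
proof
  show "range map_up \<subseteq> carrier (UP R)" using map_up_closed by (auto simp: UP_def)
  show "carrier (UP R) \<subseteq> range map_up"
  proof
    fix q assume "q \<in> carrier (UP R)"
    then obtain n where q: "\<And>i. q i \<in> carrier R" and n: "bound \<zero> n q" by (auto simp: UP_def up_def)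
    then have "\<forall>i. \<exists>a. f a = q i" using surj by (metis imageE)
    then obtain c where c: "\<And>i. f (c i) = q i" by metis
    have "map_up (Poly (map c [0..<Suc n])) = q"
      using n by (auto simp: map_up_def fun_eq_iff nth_default_def c bound.bound simp del: upt_Suc)
    then show "q \<in> range map_up" by auto
  qed
qed

lemma map_up_eq_zero: "map_up P = \<zero>\<^bsub>UP R\<^esub> \<longleftrightarrow> (\<forall>i. f (coeff P i) = \<zero>)"
  by (simp add: map_up_def UP_def fun_eq_iff)

lemma map_up_monom: "map_up (Polynomial.monom a n) = up_ring.monom (UP R) (f a) n"
  by (auto simp: map_up_def UP_def fun_eq_iff)

end

section \<open>Chain rings\<close>

text \<open>The element \<open>y\<close> is a uniformizer: every element will be a unit times a power of \<open>y\<close>, and \<open>s\<close> is the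
last exponent at which the power does not vanish.  The requirement on nonunits is the ring-theoretic
content; it says that \<open>(y)\<close> is the only maximal ideal.\<close>

definition chain_gen :: "('a, 'b) ring_scheme \<Rightarrow> nat \<Rightarrow> 'a \<Rightarrow> bool" where
  "chain_gen R s y \<longleftrightarrow> y \<in> carrier R \<and> y [^]\<^bsub>R\<^esub> Suc s = \<zero>\<^bsub>R\<^esub> \<and> y [^]\<^bsub>R\<^esub> s \<noteq> \<zero>\<^bsub>R\<^esub>
     \<and> (\<forall>a\<in>carrier R. a \<in> Units R \<or> (\<exists>b\<in>carrier R. a = y \<otimes>\<^bsub>R\<^esub> b))"

context cring
begin

lemma chain_genD:
  assumes "chain_gen R s y"
  shows "y \<in> carrier R" "y [^] Suc s = \<zero>" "y [^] s \<noteq> \<zero>"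
    "a \<in> carrier R \<Longrightarrow> a \<notin> Units R \<Longrightarrow> \<exists>b\<in>carrier R. a = y \<otimes> b"
proof -
  note D = assms[unfolded chain_gen_def]
  note D' = D[THEN conjunct2] and D'' = D[THEN conjunct2, THEN conjunct2]
  show "y \<in> carrier R" by (rule D[THEN conjunct1])
  show "y [^] Suc s = \<zero>" by (rule D'[THEN conjunct1])
  show "y [^] s \<noteq> \<zero>" by (rule D''[THEN conjunct1])
  show "\<exists>b\<in>carrier R. a = y \<otimes> b" if "a \<in> carrier R" "a \<notin> Units R"
    using D''[THEN conjunct2, rule_format, OF that(1)] that(2) by (simp only: simp_thms)
qed

text \<open>As long as the cofactor is a nonunit, another factor \<open>y\<close> can be split off.  After \<open>s + 1\<close> steps the
power of \<open>y\<close> is zero, so the process stops.\<close>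

lemma chain_gen_factor:
  assumes y: "chain_gen R s y" and a: "a \<in> carrier R"
  shows "\<exists>i\<le>Suc s. \<exists>u\<in>Units R. a = u \<otimes> y [^] i"
proof -
  note D = chain_genD[OF y]
  have "(\<exists>i<k. \<exists>u\<in>Units R. a = u \<otimes> y [^] i) \<or> (\<exists>b\<in>carrier R. a = b \<otimes> y [^] k)" for k :: nat
  proof (induction k)
    case (Suc k)
    then consider (1) "\<exists>i<k. \<exists>u\<in>Units R. a = u \<otimes> y [^] i" | (2) "\<exists>b\<in>carrier R. a = b \<otimes> y [^] k" by blast
    then show ?case
    proof cases
      case 1
      then show ?thesis using less_Suc_eq by blast
    next
      case 2
      then obtain b where b: "b \<in> carrier R" "a = b \<otimes> y [^] k" by blast
      show ?thesis
      proof (cases "b \<in> Units R")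
        case True
        then show ?thesis using b by blast
      next
        case False
        then obtain c where "c \<in> carrier R" "b = y \<otimes> c" using D(4) b by blast
        then have "a = c \<otimes> y [^] Suc k" using b D(1) by (simp add: m_ac)
        then show ?thesis using \<open>c \<in> carrier R\<close> by blast
      qed
    qed
  qed (use a in auto)
  from this[of "Suc s"] show ?thesis
  proof
    assume "\<exists>b\<in>carrier R. a = b \<otimes> y [^] Suc s"
    then have "a = \<one> \<otimes> y [^] Suc s" using D(2) by (auto simp del: nat_pow_Suc)
    then show ?thesis by blast
  qed (meson less_imp_le)
qed

lemma chain_gen_pow_eq_zero_iff:
  assumes y: "chain_gen R s y"
  shows "y [^] k = \<zero> \<longleftrightarrow> s < k"
proof -
  note D = chain_genD[OF y]
  have *: "y [^] (i + j) = \<zero>" if "y [^] i = \<zero>" for i j :: nat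
    using that D(1) by (simp add: nat_pow_mult[symmetric])
  have "y [^] k = \<zero>" if "s < k" using *[of "Suc s" "k - Suc s"] that D(2) by simp
  moreover have "y [^] k \<noteq> \<zero>" if "\<not> s < k" using *[of k "s - k"] that D(3) by auto
  ultimately show ?thesis by blast
qed

text \<open>An ideal is determined by the least exponent of a power of \<open>y\<close> in it, since units can be
cancelled.  The \<open>s + 2\<close> powers give distinct ideals: an inclusion in the wrong direction would, after
multiplication by a power of \<open>y\<close>, express \<open>y\<^sup>s\<close> as a multiple of a vanishing power.\<close>

lemma chain_gen_ideals:
  fixes i j :: nat
  assumes y: "chain_gen R s y"
  shows "{I. ideal I R} = (\<lambda>i. PIdl (y [^] i)) ` {..Suc s}"
    and "inj_on (\<lambda>i. PIdl (y [^] i)) {..Suc s}"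
    and "i \<le> j \<Longrightarrow> PIdl (y [^] j) \<subseteq> PIdl (y [^] i)"
proof -
  note D = chain_genD[OF y]
  have mono: "PIdl (y [^] j) \<subseteq> PIdl (y [^] i)" if "i \<le> j" for i j :: nat
  proof -
    have "y [^] j = y [^] (j - i) \<otimes> y [^] i" using that D(1) by (simp add: nat_pow_mult)
    then have "y [^] j \<in> PIdl (y [^] i)" using D(1) by (auto simp: cgenideal_def)
    then show ?thesis using D(1) by (intro cgenideal_minimal cgenideal_ideal) auto
  qed
  then show "i \<le> j \<Longrightarrow> PIdl (y [^] j) \<subseteq> PIdl (y [^] i)" by blast
  have strict: False if "i < j" "j \<le> Suc s" "PIdl (y [^] i) \<subseteq> PIdl (y [^] j)" for i j :: nat
  proof -
    have "y [^] i \<in> PIdl (y [^] j)" using cgenideal_self[of "y [^] i"] D(1) that(3) by auto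
    then obtain b where b: "b \<in> carrier R" "y [^] i = b \<otimes> y [^] j" by (auto simp: cgenideal_def)
    have "y [^] s = y [^] i \<otimes> y [^] (s - i)" using that D(1) by (simp add: nat_pow_mult)
    also have "\<dots> = b \<otimes> (y [^] (j + (s - i)))" using b D(1) by (simp add: nat_pow_mult[symmetric] m_assoc)
    also have "y [^] (j + (s - i)) = \<zero>" using that chain_gen_pow_eq_zero_iff[OF y] by auto
    finally show False using D(3) b by simp
  qed
  show "inj_on (\<lambda>i. PIdl (y [^] i)) {..Suc s}"
    by (rule linorder_inj_onI) (use strict in \<open>auto simp: less_imp_le\<close>)
  show "{I. ideal I R} = (\<lambda>i. PIdl (y [^] i)) ` {..Suc s}"
  proof safe
    fix I assume "ideal I R"
    then interpret I: ideal I R .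
    have ex: "y [^] Suc s \<in> I" using D(2) by simp
    define i where "i = (LEAST i::nat. y [^] i \<in> I)"
    have i: "y [^] i \<in> I" "i \<le> Suc s"
      unfolding i_def by (rule LeastI[of _ "Suc s"], rule ex) (rule Least_le, rule ex)
    have "I = PIdl (y [^] i)"
    proof
      show "PIdl (y [^] i) \<subseteq> I" using i by (intro cgenideal_minimal I.is_ideal)
      show "I \<subseteq> PIdl (y [^] i)"
      proof
        fix a assume a: "a \<in> I"
        then have "a \<in> carrier R" using I.a_subset by auto
        then obtain j :: nat and u where ju: "u \<in> Units R" "a = u \<otimes> y [^] j" using chain_gen_factor[OF y] by blast
        have "inv u \<otimes> a \<in> I" using I.I_l_closed[OF a, of "inv u"] ju(1) by simp
        also have "inv u \<otimes> a = y [^] j" using ju D(1) by (simp add: m_assoc[symmetric] Units_closed)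
        finally have "i \<le> j" unfolding i_def by (rule Least_le)
        have "a \<in> PIdl (y [^] j)" using ju by (auto simp: cgenideal_def)
        then show "a \<in> PIdl (y [^] i)" using mono[OF \<open>i \<le> j\<close>] by blast
      qed
    qed
    then show "I \<in> (\<lambda>i. PIdl (y [^] i)) ` {..Suc s}" using i by auto
  next
    fix i :: nat show "ideal (PIdl (y [^] i)) R" using D(1) by (intro cgenideal_ideal) auto
  qed
qed

lemma chain_gen_maximalideal:
  assumes y: "chain_gen R s y"
  shows "maximalideal (PIdl y) R"
proof (rule maximalidealI)
  note D = chain_genD[OF y]
  show "ideal (PIdl y) R" by (rule cgenideal_ideal[OF D(1)])
  show "carrier R \<noteq> PIdl y"
  proof
    assume "carrier R = PIdl y"
    then obtain b where b: "b \<in> carrier R" "\<one> = b \<otimes> y" unfolding cgenideal_def by blast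
    have "y [^] s = y [^] s \<otimes> (b \<otimes> y)" using D(1) by (simp add: b(2)[symmetric])
    also have "\<dots> = b \<otimes> y [^] Suc s" using b(1) D(1) by (simp add: m_ac)
    finally show False using D(2,3) b(1) by (simp del: nat_pow_Suc)
  qed
  fix J assume J: "ideal J R" "PIdl y \<subseteq> J" "J \<subseteq> carrier R"
  interpret J: ideal J R by (rule J(1))
  show "J = PIdl y \<or> J = carrier R"
  proof (rule disjCI)
    assume "J \<noteq> carrier R"
    have "a \<in> PIdl y" if a: "a \<in> J" for a
    proof (rule ccontr)
      assume na: "a \<notin> PIdl y"
      have ac: "a \<in> carrier R" using J(3) a by blast
      have "a \<in> Units R"
      proof (rule ccontr)
        assume "a \<notin> Units R"
        then obtain b where "b \<in> carrier R" "a = y \<otimes> b" using D(4)[OF ac] by blast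
        then have "a = b \<otimes> y" using m_comm D(1) by simp
        then show False using na \<open>b \<in> carrier R\<close> unfolding cgenideal_def by blast
      qed
      then have "inv a \<otimes> a = \<one>" "inv a \<in> carrier R" by simp_all
      then have "\<one> \<in> J" using J.I_l_closed[OF a, of "inv a"] by simp
      then show False using J.one_imp_carrier \<open>J \<noteq> carrier R\<close> by blast
    qed
    then show "J = PIdl y" using J(2) by blast
  qed
qed

text \<open>The exponents \<open>0\<close> and \<open>s + 1\<close> give the unit ideal and the zero ideal, so \<open>s\<close> nontrivial ideals remain.\<close>

lemma chain_gen_imp:
  assumes y: "chain_gen R s y"
  shows "is_local_ring R" and "is_PIR R" and "card (nontrivial_ideals R) = s"
proof -
  note D = chain_genD[OF y] and I = chain_gen_ideals[OF y]
  let ?P = "\<lambda>i::nat. PIdl (y [^] i)"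
  have id: "ideal J R \<longleftrightarrow> (\<exists>i\<le>Suc s. J = ?P i)" for J using I(1) by (auto simp: set_eq_iff image_iff)
  have P0: "?P 0 = carrier R" by (auto simp: cgenideal_def) (metis r_one)
  have Ps: "?P (Suc s) = {\<zero>}" unfolding D(2) by (auto simp: cgenideal_def intro!: exI[of _ \<zero>])
  show "is_PIR R" unfolding is_PIR_def
  proof (intro conjI allI impI)
    fix J assume "ideal J R"
    then show "principalideal J R"
      using id D(1) cgenideal_is_principalideal[of "y [^] _"] by auto
  qed (rule is_cring)
  have inj: "?P i = ?P j \<longleftrightarrow> i = j" if "i \<le> Suc s" "j \<le> Suc s" for i j
    using I(2) that by (auto simp: inj_on_def)
  have "nontrivial_ideals R = ?P ` {1..s}"
  proof
    show "nontrivial_ideals R \<subseteq> ?P ` {1..s}"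
    proof
      fix J assume J: "J \<in> nontrivial_ideals R"
      then obtain i where i: "i \<le> Suc s" "J = ?P i" unfolding nontrivial_ideals_def using id by blast
      then have "i \<noteq> 0" "i \<noteq> Suc s" using J P0 Ps unfolding nontrivial_ideals_def by auto
      then show "J \<in> ?P ` {1..s}" using i by auto
    qed
    show "?P ` {1..s} \<subseteq> nontrivial_ideals R"
    proof
      fix J assume "J \<in> ?P ` {1..s}"
      then obtain i where i: "1 \<le> i" "i \<le> s" "J = ?P i" by auto
      then have "ideal J R" using id le_SucI by blast
      moreover have "J \<noteq> carrier R" "J \<noteq> {\<zero>}"
        using i inj[of i 0] inj[of i "Suc s"] P0 Ps by auto
      ultimately show "J \<in> nontrivial_ideals R" unfolding nontrivial_ideals_def by auto
    qed
  qed
  moreover have "inj_on ?P {1..s}" by (rule inj_on_subset[OF I(2)]) auto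
  ultimately show "card (nontrivial_ideals R) = s" by (simp add: card_image)
  have sub: "ideal J R \<Longrightarrow> J \<noteq> carrier R \<Longrightarrow> J \<subseteq> ?P 1" for J
    using id[of J] P0 I(3)[of 1] by (metis One_nat_def Suc_leI neq0_conv)
  have id1: "ideal (?P 1) R" using D(1) by (intro cgenideal_ideal) auto
  have ne: "?P 1 \<noteq> carrier R" using inj[of 1 0] P0 by auto
  show "is_local_ring R" unfolding is_local_ring_def
  proof (intro conjI ex1I is_cring)
    show "maximalideal (?P 1) R" using chain_gen_maximalideal[OF y] D(1) by simp
    show "M = ?P 1" if "maximalideal M R" for M
    proof -
      interpret M: maximalideal M R by fact
      show ?thesis
        using M.I_maximal[OF id1] sub[OF M.is_ideal] M.I_notcarr ne ideal.Icarr[OF id1] by blast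
    qed
  qed
qed

text \<open>A finite ring has finitely many ideals, so a largest proper ideal containing the principal one exists
without an appeal to Zorn's lemma.\<close>

lemma finite_nonunit_in_maximalideal:
  assumes fin: "finite (carrier R)" and a: "a \<in> carrier R" "a \<notin> Units R"
  shows "\<exists>M. maximalideal M R \<and> a \<in> M"
proof -
  define F where "F = {J. ideal J R \<and> a \<in> J \<and> J \<noteq> carrier R}"
  have "F \<subseteq> Pow (carrier R)"
  proof
    fix J assume "J \<in> F"
    then have "ideal J R" by (simp add: F_def)
    then show "J \<in> Pow (carrier R)" using ideal.Icarr[of J R] by auto
  qed
  then have finF: "finite F" using fin finite_subset by blast
  have "PIdl a \<in> F" unfolding F_def
    using a cgenideal_ideal cgenideal_self
    by (auto simp: cgenideal_def Units_def m_comm set_eq_iff) (metis m_comm one_closed)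
  then obtain M where M: "M \<in> F" and max: "\<And>J. J \<in> F \<Longrightarrow> M \<subseteq> J \<Longrightarrow> M = J"
    using finite_has_maximal[OF finF] by auto
  have "maximalideal M R"
    by (rule maximalidealI) (use M max in \<open>auto simp: F_def\<close>)
  then show ?thesis using M unfolding F_def by blast
qed

text \<open>A generator \<open>y\<close> of the maximal ideal is a uniformizer.  It is nilpotent because its powers repeat:
from \<open>y\<^sup>i = y\<^sup>i\<^sup>+\<^sup>k\<close> with \<open>k > 0\<close> the unit \<open>1 - y\<^sup>k\<close> can be cancelled.\<close>

lemma finite_local_PIR_imp_chain_gen:
  assumes fin: "finite (carrier R)" and loc: "is_local_ring R" and pir: "is_PIR R"
  shows "\<exists>s y. chain_gen R s y"
proof -
  obtain M where M: "maximalideal M R" and uniq: "\<And>M'. maximalideal M' R \<Longrightarrow> M' = M"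
    using loc unfolding is_local_ring_def by auto
  interpret M: maximalideal M R by (rule M)
  have nonunit: "a \<in> M" if "a \<in> carrier R" "a \<notin> Units R" for a
    using finite_nonunit_in_maximalideal[OF fin that] uniq by blast
  have one: "\<one> \<notin> M" using M.one_imp_carrier M.I_notcarr by auto
  have "principalideal M R" using pir M.is_ideal unfolding is_PIR_def by blast
  then obtain y where y: "y \<in> carrier R" "M = PIdl y"
    using principalideal.generate cgenideal_eq_genideal by metis
  have "\<not> inj (\<lambda>n::nat. y [^] n)"
    using y(1) fin by (metis finite_imageD finite_subset image_subsetI infinite_UNIV_nat nat_pow_closed)
  then obtain i j :: nat where "i < j" and ij: "y [^] i = y [^] j"
    by (meson linorder_injI)
  define k where "k = j - i"
  have k: "k > 0" "y [^] j = y [^] i \<otimes> y [^] k"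
    using \<open>i < j\<close> y(1) by (auto simp: k_def nat_pow_mult)
  have yM: "y \<in> M" using y cgenideal_self by auto
  have ykM: "y [^] k \<in> M"
  proof -
    obtain k' where "k = Suc k'" using k gr0_conv_Suc by blast
    then show ?thesis using yM y(1) by (simp add: M.I_l_closed)
  qed
  have "\<one> \<ominus> y [^] k \<in> Units R"
  proof (rule ccontr)
    assume "\<one> \<ominus> y [^] k \<notin> Units R"
    then have "\<one> \<ominus> y [^] k \<in> M" using nonunit y(1) by auto
    then have "(\<one> \<ominus> y [^] k) \<oplus> y [^] k \<in> M" using ykM by auto
    then show False using one y(1) by (simp add: a_minus_def a_assoc l_neg)
  qed
  then obtain v where v: "v \<in> carrier R" "(\<one> \<ominus> y [^] k) \<otimes> v = \<one>" unfolding Units_def by auto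
  have "y [^] i \<otimes> (\<one> \<ominus> y [^] k) = \<zero>"
    using y(1) ij k by (simp add: a_minus_def r_distr r_minus r_neg)
  then have "(y [^] i \<otimes> (\<one> \<ominus> y [^] k)) \<otimes> v = \<zero>" using v by simp
  then have yi: "y [^] i = \<zero>" using v y(1) by (simp add: m_assoc)
  define m where "m = (LEAST m. y [^] (m::nat) = \<zero>)"
  have m: "y [^] m = \<zero>" unfolding m_def by (rule LeastI[of _ i]) (rule yi)
  have "m \<noteq> 0"
  proof
    assume "m = 0"
    then have "\<one> = \<zero>" using m by simp
    then show False using one M.zero_closed by simp
  qed
  then obtain s where s: "m = Suc s" by (cases m) auto
  have "y [^] s \<noteq> \<zero>" using not_less_Least[of s "\<lambda>m. y [^] (m::nat) = \<zero>"] s unfolding m_def by auto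
  moreover have "\<exists>b\<in>carrier R. a = y \<otimes> b" if a: "a \<in> carrier R" "a \<notin> Units R" for a
  proof -
    obtain b where "b \<in> carrier R" "a = b \<otimes> y"
      using nonunit[OF a] unfolding y(2) cgenideal_def by blast
    then show ?thesis using y(1) m_comm by blast
  qed
  ultimately have "chain_gen R s y" unfolding chain_gen_def using y(1) m[unfolded s] by blast
  then show ?thesis by blast
qed

text \<open>The number of nontrivial ideals fixes the nilpotency index, hence the same \<open>s\<close> occurs on both sides.\<close>

theorem finite_local_PIR_iff_chain_gen:
  assumes fin: "finite (carrier R)"
  shows "is_local_ring R \<and> is_PIR R \<and> card (nontrivial_ideals R) = s \<longleftrightarrow> (\<exists>y. chain_gen R s y)"
  using finite_local_PIR_imp_chain_gen[OF fin] chain_gen_imp by metis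

text \<open>The characteristic divides every \<open>n\<close> with \<open>n \<cdot> 1 = 0\<close>, and the proper divisors of \<open>p\<^sup>r\<close> divide
\<open>p\<^sup>r\<^sup>-\<^sup>1\<close>; two evaluations therefore decide.\<close>

lemma ring_char_eq_prime_power_iff:
  assumes p: "prime (p::nat)" and r: "r \<ge> 1"
  shows "ring_char R = p ^ r \<longleftrightarrow> [(p ^ r)] \<cdot> \<one> = \<zero> \<and> [(p ^ (r - 1))] \<cdot> \<one> \<noteq> \<zero>"
proof -
  interpret Z: class_ring_hom R "\<lambda>n::int. [n] \<cdot> \<one>" by (rule class_ring_hom_of_int)
  let ?P = "\<lambda>n::nat. 0 < n \<and> [n] \<cdot> \<one> = \<zero>"
  have ppos: "p ^ k > 0" for k using p by (simp add: prime_gt_0_nat)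
  have add: "[(m + n)] \<cdot> \<one> = [m] \<cdot> \<one> \<oplus> [n] \<cdot> \<one>" for m n :: nat by (simp add: add.nat_pow_mult)
  have mult: "[(m * n)] \<cdot> \<one> = [m] \<cdot> \<one> \<otimes> [n] \<cdot> \<one>" for m n :: nat
    using Z.hom_mult[of "int m" "int n"] by (simp add: add_pow_int_ge nat_mult_distrib)
  have dvd0: "[n] \<cdot> \<one> = \<zero>" if "m dvd n" "[m] \<cdot> \<one> = \<zero>" for m n :: nat
    using that by (auto simp: mult)
  have dvd: "ring_char R dvd n" if n: "[n] \<cdot> \<one> = \<zero>" "n > 0" for n
  proof -
    let ?c = "LEAST n. ?P n"
    have "\<exists>n. ?P n" using n by blast
    then have c: "ring_char R = ?c" unfolding ring_char_def by simp
    have Pc: "?P ?c" by (rule LeastI[of ?P n]) (use n in auto)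
    have "[n] \<cdot> \<one> = [(n div ?c * ?c)] \<cdot> \<one> \<oplus> [(n mod ?c)] \<cdot> \<one>" by (simp flip: add)
    then have "[(n mod ?c)] \<cdot> \<one> = \<zero>" using n Pc by (simp add: mult)
    then have "n mod ?c = 0" using not_less_Least[of "n mod ?c" ?P] Pc by auto
    then show ?thesis using c by auto
  qed
  show ?thesis
  proof
    assume c: "ring_char R = p ^ r"
    then have ex: "\<exists>n. ?P n" unfolding ring_char_def using ppos by (metis less_numeral_extra(3))
    then have c': "(LEAST n. ?P n) = p ^ r" using c unfolding ring_char_def by simp
    have "[(p ^ r)] \<cdot> \<one> = \<zero>" using LeastI_ex[OF ex] unfolding c' by simp
    moreover have "p ^ (r - 1) < p ^ r" using r p by (simp add: prime_gt_Suc_0_nat)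
    then have "[(p ^ (r - 1))] \<cdot> \<one> \<noteq> \<zero>"
      using not_less_Least[of "p ^ (r - 1)" ?P] ppos unfolding c' by auto
    ultimately show "[(p ^ r)] \<cdot> \<one> = \<zero> \<and> [(p ^ (r - 1))] \<cdot> \<one> \<noteq> \<zero>" by blast
  next
    assume a: "[(p ^ r)] \<cdot> \<one> = \<zero> \<and> [(p ^ (r - 1))] \<cdot> \<one> \<noteq> \<zero>"
    then have "ring_char R dvd p ^ r" using dvd ppos by blast
    then obtain k where k: "k \<le> r" "ring_char R = p ^ k" using p divides_primepow_nat by blast
    have ex: "\<exists>n. ?P n" using a ppos by blast
    have "[(ring_char R)] \<cdot> \<one> = \<zero>" using LeastI_ex[OF ex] ex unfolding ring_char_def by auto
    then have "\<not> k \<le> r - 1" using a dvd0[of "p ^ k" "p ^ (r - 1)"] k by (auto simp: le_imp_power_dvd)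
    then show "ring_char R = p ^ r" using k r by (metis Suc_diff_1 le_SucE less_eq_Suc_le One_nat_def)
  qed
qed

end

lemma class_ring_hom_residue_ring:
  assumes "m > 1"
  shows "class_ring_hom (residue_ring m) (\<lambda>n. n mod m)"
proof -
  interpret residues m "residue_ring m" using assms by unfold_locales auto
  show ?thesis
    by unfold_locales (use assms in \<open>auto simp: residue_ring_def mod_simps\<close>)
qed

lemma range_mod_residue_ring:
  assumes "m > 1"
  shows "range (\<lambda>n. n mod m) = carrier (residue_ring m)"
proof
  show "carrier (residue_ring m) \<subseteq> range (\<lambda>n. n mod m)"
    by (auto simp: residue_ring_def intro!: image_eqI[of x _ x for x])
qed (use assms in \<open>auto simp: residue_ring_def\<close>)

section \<open>Integer polynomials modulo a prime\<close>

definition unit_mod :: "int \<Rightarrow> int poly \<Rightarrow> bool" where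
  "unit_mod p a \<longleftrightarrow> (\<exists>b. [:p:] dvd a * b - 1)"

text \<open>Irreducibility of the image in \<open>\<int>\<^sub>p[X]\<close>, phrased with integer representatives.\<close>

definition irreducible_mod :: "int \<Rightarrow> int poly \<Rightarrow> bool" where
  "irreducible_mod p g \<longleftrightarrow> \<not> [:p:] dvd g \<and> \<not> unit_mod p g
     \<and> (\<forall>a b. [:p:] dvd g - a * b \<longrightarrow> unit_mod p a \<or> unit_mod p b)"

text \<open>Modulo \<open>p\<close>, leading terms divisible by \<open>p\<close> may be dropped, and a leading coefficient prime to \<open>p\<close>
has an inverse.  This normalization is what makes \<open>\<int>\<^sub>p[X]\<close> behave like a polynomial ring over a
field.\<close>

lemma monic_multiple_mod_prime:
  fixes a :: "int poly"
  assumes "prime p" "\<not> [:p:] dvd a"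
  shows "\<exists>c k. lead_coeff k = 1 \<and> degree k \<le> degree a \<and> [:p:] dvd k - smult c a"
  using assms(2)
proof (induction "degree a" arbitrary: a rule: less_induct)
  case less
  show ?case
  proof (cases "p dvd lead_coeff a")
    case True
    define a' where "a' = a - Polynomial.monom (lead_coeff a) (degree a)"
    have m: "[:p:] dvd Polynomial.monom (lead_coeff a) (degree a)"
      using True by (simp add: const_poly_dvd_iff)
    then have a': "\<not> [:p:] dvd a'" using less.prems dvd_add[OF _ m, of a'] unfolding a'_def by auto
    have "degree a \<noteq> 0"
    proof
      assume "degree a = 0"
      then have "a' = 0" unfolding a'_def by (auto elim!: degree_eq_zeroE simp: monom_0)
      then show False using a' by simp
    qed
    have "degree a' \<le> degree a - 1"
    proof (rule degree_le, intro allI impI)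
      fix i assume "degree a - 1 < i"
      then show "coeff a' i = 0" using \<open>degree a \<noteq> 0\<close>
        by (cases "i = degree a") (auto simp: a'_def coeff_eq_0)
    qed
    then have deg: "degree a' < degree a" using \<open>degree a \<noteq> 0\<close> by simp
    obtain c k where k: "lead_coeff k = 1" "degree k \<le> degree a'" "[:p:] dvd k - smult c a'"
      using less.hyps[OF deg a'] by blast
    have eq: "k - smult c a = (k - smult c a') - smult c (Polynomial.monom (lead_coeff a) (degree a))"
      by (simp add: a'_def smult_diff_right)
    have "[:p:] dvd k - smult c a" unfolding eq by (rule dvd_diff[OF k(3) dvd_smult[OF m]])
    then show ?thesis using k deg by (meson le_trans less_imp_le)
  next
    case False
    then have "coprime (lead_coeff a) p"
      using assms(1) prime_imp_coprime coprime_commute by blast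
    then obtain c l where cl: "c * lead_coeff a + l * p = 1"
      using bezout_int[of "lead_coeff a" p] by auto
    define k where "k = smult c a + Polynomial.monom (l * p) (degree a)"
    have ck: "coeff k (degree a) = 1" using cl by (simp add: k_def)
    have dk: "degree k \<le> degree a"
      unfolding k_def by (intro degree_add_le degree_smult_le degree_monom_le)
    then have "degree k = degree a" using ck le_degree[of k "degree a"] by simp
    moreover have "[:p:] dvd k - smult c a" by (simp add: k_def const_poly_dvd_iff)
    ultimately show ?thesis using ck by (intro exI[of _ c] exI[of _ k]) simp
  qed
qed

lemma monic_division:
  fixes a g :: "int poly"
  assumes "lead_coeff g = 1"
  shows "\<exists>q r. a = g * q + r \<and> (r = 0 \<or> degree r < degree g)"
proof -
  have "g \<noteq> 0" using assms by auto
  then show ?thesis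
    using pseudo_divmod[of g a "fst (pseudo_divmod a g)" "snd (pseudo_divmod a g)"] assms by auto
qed

lemma smult_in_class_ideal: "class_ideal I \<Longrightarrow> a \<in> I \<Longrightarrow> smult c a \<in> I"
  using class_idealD(3)[of I a "[:c:]"] by simp

lemma dvd_in_class_ideal: "class_ideal I \<Longrightarrow> a \<in> I \<Longrightarrow> a dvd b \<Longrightarrow> b \<in> I"
  by (auto elim!: dvdE intro: class_idealD)

text \<open>This is the statement that \<open>\<int>\<^sub>p[X]\<close> is a principal ideal domain, pulled back to \<open>\<int>[X]\<close>: an ideal
containing \<open>p\<close> and a monic polynomial is \<open>(p, k)\<close> with \<open>k\<close> monic of least degree.\<close>

lemma ideal_over_prime_monic_generator:
  fixes J :: "int poly set"
  assumes p: "prime p" and J: "class_ideal J" "[:p:] \<in> J" and g: "g \<in> J" "lead_coeff g = 1"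
  obtains k where "k \<in> J" "lead_coeff k = 1"
    and "\<And>j. j \<in> J \<Longrightarrow> \<not> [:p:] dvd j \<Longrightarrow> degree k \<le> degree j"
    and "\<And>j. j \<in> J \<Longrightarrow> \<exists>q. [:p:] dvd j - k * q"
proof -
  note D = class_idealD[OF J(1)]
  obtain k where k: "k \<in> J" "lead_coeff k = 1"
    and min: "\<And>k'. k' \<in> J \<Longrightarrow> lead_coeff k' = 1 \<Longrightarrow> degree k \<le> degree k'"
    using ex_has_least_nat[of "\<lambda>k. k \<in> J \<and> lead_coeff k = 1" g degree] g by blast
  have low: "degree k \<le> degree r" if r: "r \<in> J" "\<not> [:p:] dvd r" for r
  proof -
    obtain c k' where k': "lead_coeff k' = 1" "degree k' \<le> degree r" "[:p:] dvd k' - smult c r"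
      using monic_multiple_mod_prime[OF p r(2)] by blast
    have "k' - smult c r \<in> J" by (rule dvd_in_class_ideal[OF J k'(3)])
    then have "k' \<in> J" using D(2)[OF _ smult_in_class_ideal[OF J(1) r(1)], of "k' - smult c r" c] by simp
    then show ?thesis using min k' by force
  qed
  have "\<exists>q. [:p:] dvd j - k * q" if j: "j \<in> J" for j
  proof -
    obtain q r where qr: "j = k * q + r" "r = 0 \<or> degree r < degree k"
      using monic_division[OF k(2)] by blast
    have "r = j - k * q" using qr by simp
    then have rJ: "r \<in> J" using D(6)[OF j D(4)[OF k(1)]] by simp
    have "[:p:] dvd r" using low[OF rJ] qr(2) by (cases "[:p:] dvd r") auto
    then show ?thesis using qr by (intro exI[of _ q]) simp
  qed
  then show thesis using that k low by blast
qed

text \<open>The ideal \<open>(w, p, g)\<close> is \<open>(p, k)\<close> for some monic \<open>k\<close>, and \<open>k\<close> divides \<open>g\<close> modulo \<open>p\<close>.  By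
irreducibility \<open>k\<close> is a unit modulo \<open>p\<close>, or \<open>k\<close> and \<open>g\<close> generate the same ideal modulo \<open>p\<close>; the
latter would put \<open>w\<close> into \<open>(p, g)\<close>.\<close>

lemma maximal_if_irreducible_mod:
  assumes p: "prime p" and g: "lead_coeff g = 1" "irreducible_mod p g"
    and w: "w \<notin> ideal_of [[:p:], g]"
  shows "1 \<in> ideal_of [w, [:p:], g]"
proof -
  define J where "J = ideal_of [w, [:p:], g]"
  have J: "class_ideal J" unfolding J_def by (rule class_ideal_ideal_of)
  note D = class_idealD[OF J]
  have "{w, [:p:], g} \<subseteq> J" using generators_in_ideal_of[of "[w, [:p:], g]"] unfolding J_def by simp
  then have gen: "w \<in> J" "[:p:] \<in> J" "g \<in> J" by auto
  obtain k where k: "k \<in> J" "lead_coeff k = 1" and mult: "\<And>j. j \<in> J \<Longrightarrow> \<exists>q. [:p:] dvd j - k * q"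
    using ideal_over_prime_monic_generator[OF p J gen(2,3) g(1)] by metis
  let ?I = "ideal_of [[:p:], g]"
  have I: "class_ideal ?I" by (rule class_ideal_ideal_of)
  note DI = class_idealD[OF I]
  have "{[:p:], g} \<subseteq> ?I" using generators_in_ideal_of[of "[[:p:], g]"] by simp
  then have genI: "[:p:] \<in> ?I" "g \<in> ?I" by auto
  obtain q where q: "[:p:] dvd g - k * q" using mult gen by blast
  then consider "unit_mod p k" | "unit_mod p q" using g(2) unfolding irreducible_mod_def by blast
  then have "1 \<in> J"
  proof cases
    case 1
    then obtain b where "[:p:] dvd k * b - 1" unfolding unit_mod_def by blast
    then have "k * b - 1 \<in> J" by (rule dvd_in_class_ideal[OF J gen(2)])
    then have "k * b - (k * b - 1) \<in> J" by (rule D(6)[OF D(4)[OF k(1)]])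
    then show ?thesis by simp
  next
    case 2
    then obtain b where "[:p:] dvd q * b - 1" unfolding unit_mod_def by blast
    then have 1: "q * b - 1 \<in> ?I" by (rule dvd_in_class_ideal[OF I genI(1)])
    have 2: "g - k * q \<in> ?I" using q by (rule dvd_in_class_ideal[OF I genI(1)])
    have "(g * b - (g - k * q) * b) - k * (q * b - 1) \<in> ?I"
      by (rule DI(6)[OF DI(6)[OF DI(4)[OF genI(2)] DI(4)[OF 2]] DI(3)[OF 1]])
    then have kI: "k \<in> ?I" by (simp add: algebra_simps)
    obtain q' where "[:p:] dvd w - k * q'" using mult gen by blast
    then have "w - k * q' \<in> ?I" by (rule dvd_in_class_ideal[OF I genI(1)])
    then have "(w - k * q') + k * q' \<in> ?I" by (rule DI(2)[OF _ DI(4)[OF kI]])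
    then show ?thesis using w by simp
  qed
  then show ?thesis unfolding J_def .
qed

text \<open>Canonical representatives of \<open>\<int>[X]/(p, g)\<close> for a monic \<open>g\<close> of degree \<open>d\<close>.  They play the role of
the digits \<open>0, \<dots>, p - 1\<close> in \<open>p\<close>-adic expansions.\<close>

definition digits :: "int \<Rightarrow> nat \<Rightarrow> int poly set" where
  "digits p d = {w. \<forall>i. coeff w i \<in> {0..<p} \<and> (d \<le> i \<longrightarrow> coeff w i = 0)}"

lemma finite_digits: "finite (digits p d)"
proof -
  have "digits p d \<subseteq> Poly ` {xs. set xs \<subseteq> {0..<p} \<and> length xs = d}"
  proof
    fix w assume w: "w \<in> digits p d"
    have "w = Poly (map (coeff w) [0..<d])"
      using w by (intro poly_eqI) (auto simp: nth_default_def digits_def)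
    moreover have "set (map (coeff w) [0..<d]) \<subseteq> {0..<p}" using w by (auto simp: digits_def)
    ultimately show "w \<in> Poly ` {xs. set xs \<subseteq> {0..<p} \<and> length xs = d}"
      by (intro image_eqI[of _ _ "map (coeff w) [0..<d]"]) auto
  qed
  then show ?thesis using finite_lists_length_eq[of "{0..<p}" d] by (simp add: finite_subset)
qed

lemma digits_eq_0: "w \<in> digits p d \<Longrightarrow> [:p:] dvd w \<Longrightarrow> w = 0"
proof (intro poly_eqI)
  fix i assume w: "w \<in> digits p d" and p: "[:p:] dvd w"
  have "0 \<le> coeff w i" "coeff w i < p" using w by (auto simp: digits_def)
  moreover have "p dvd coeff w i" using p by (simp add: const_poly_dvd_iff)
  ultimately show "coeff w i = coeff 0 i"
    using zdvd_not_zless[of "coeff w i" p] by fastforce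
qed

lemma digits_degree: "w \<in> digits p d \<Longrightarrow> d > 0 \<Longrightarrow> degree w < d"
  by (intro degree_lessI) (auto simp: digits_def)

lemma zero_in_digits: "p > 0 \<Longrightarrow> 0 \<in> digits p d"
  by (simp add: digits_def)

lemma digits_representative:
  fixes a g :: "int poly"
  assumes p: "p > 0" and g: "lead_coeff g = 1"
  shows "\<exists>w\<in>digits p (degree g). a - w \<in> ideal_of [[:p:], g]"
proof -
  obtain q r where qr: "a = g * q + r" "r = 0 \<or> degree r < degree g"
    using monic_division[OF g] by blast
  define w where "w = map_poly (\<lambda>c. c mod p) r"
  have w: "coeff w i = coeff r i mod p" for i unfolding w_def by (simp add: coeff_map_poly)
  have "w \<in> digits p (degree g)" using qr(2) p by (auto simp: digits_def w coeff_eq_0)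
  moreover have "[:p:] dvd r - w" by (simp add: const_poly_dvd_iff w mod_eq_dvd_iff[symmetric])
  then obtain z where "r - w = [:p:] * z" by (rule dvdE)
  then have "a - w = z * [:p:] + q * g" using qr(1) by (simp add: algebra_simps)
  then have "a - w \<in> ideal_of [[:p:], g]" unfolding ideal_of_pair by blast
  ultimately show ?thesis by blast
qed

section \<open>Ideals of \<open>\<int>[X][Y]\<close> and expansions in powers of \<open>Y\<close>\<close>

abbreviation Yv :: "int poly poly" where "Yv \<equiv> [:0, 1:]"

lemma monom_eq_Y_power: "Polynomial.monom a n = [:a:] * Yv ^ n"
  by (simp add: monom_altdef)

lemma pCons_eq_Y: "pCons a P = [:a:] + Yv * P"
  by simp

definition p_rel :: "int \<Rightarrow> nat \<Rightarrow> (nat \<Rightarrow> int poly) \<Rightarrow> (nat \<Rightarrow> nat) \<Rightarrow> int poly poly" where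
  "p_rel p n u t = [:[:p:]:] - (\<Sum>i\<in>{1..n}. Polynomial.monom (u i) (t i))"

definition g_rel :: "int poly \<Rightarrow> nat \<Rightarrow> (nat \<Rightarrow> int poly) \<Rightarrow> (nat \<Rightarrow> nat) \<Rightarrow> int poly poly" where
  "g_rel g m v e = [:g:] - (\<Sum>j\<in>{1..m}. Polynomial.monom (v j) (e j))"

text \<open>The preimage in \<open>\<int>[X][Y]\<close> of the ideal \<open>Q\<close> of the presentation.  The additional generator \<open>p\<^sup>r\<close>
accounts for the coefficients being taken modulo \<open>p\<^sup>r\<close>.\<close>

definition Q_ideal :: "int \<Rightarrow> nat \<Rightarrow> nat \<Rightarrow> nat \<Rightarrow> nat \<Rightarrow> int poly \<Rightarrow> (nat \<Rightarrow> int poly) \<Rightarrow> (nat \<Rightarrow> int poly)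
    \<Rightarrow> (nat \<Rightarrow> nat) \<Rightarrow> (nat \<Rightarrow> nat) \<Rightarrow> int poly poly set" where
  "Q_ideal p r s n m g u v t e =
     ideal_of [[:[:p:]:] ^ r, [:[:p:]:] * Yv ^ (s + 1 - t 1), Yv ^ (s + 1), p_rel p n u t, g_rel g m v e]"

text \<open>A sum of monomials with distinct exponents is a power of \<open>Y\<close> times a cofactor whose constant term
is the lowest coefficient; the cofactor is a unit as soon as this coefficient is.\<close>

lemma sum_monom_lowest:
  assumes "finite A" "k \<in> A" "\<And>i. i \<in> A \<Longrightarrow> i \<noteq> k \<Longrightarrow> t k < t i"
  shows "\<exists>b. (\<Sum>i\<in>A. Polynomial.monom (u i) (t i)) = Yv ^ t k * ([:u k:] + Yv * b)"
proof -
  have "Polynomial.monom (u i) (t i) = Yv ^ t k * (Yv * Polynomial.monom (u i) (t i - t k - 1))"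
    if "i \<in> A - {k}" for i
  proof -
    have "t i = t k + (1 + (t i - t k - 1))" using assms(3)[of i] that by auto
    then have "Yv ^ t i = Yv ^ t k * (Yv * Yv ^ (t i - t k - 1))"
      by (metis power_add power_one_right)
    then show ?thesis unfolding monom_eq_Y_power by (simp only: mult_ac)
  qed
  then have "(\<Sum>i\<in>A - {k}. Polynomial.monom (u i) (t i))
    = Yv ^ t k * (Yv * (\<Sum>i\<in>A - {k}. Polynomial.monom (u i) (t i - t k - 1)))"
    unfolding sum_distrib_left by (intro sum.cong refl)
  moreover have "(\<Sum>i\<in>A. Polynomial.monom (u i) (t i))
      = Polynomial.monom (u k) (t k) + (\<Sum>i\<in>A - {k}. Polynomial.monom (u i) (t i))"
    using assms by (simp add: sum.remove)
  ultimately show ?thesis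
    unfolding monom_eq_Y_power[of "u k"]
    by (intro exI[of _ "\<Sum>i\<in>A - {k}. Polynomial.monom (u i) (t i - t k - 1)"])
      (simp only: distrib_left mult_ac)
qed

text \<open>The pair \<open>p, g\<close> is a regular sequence in \<open>\<int>[X]\<close>: a relation \<open>a p + b g = 0\<close> is a multiple of the
trivial relation, because the prime \<open>p\<close> does not divide the monic polynomial \<open>g\<close>.  Consequently \<open>Y\<close>
is a nonzerodivisor modulo two polynomials with constant terms \<open>p\<close> and \<open>g\<close>.\<close>

lemma regular_pair_commute:
  fixes p :: int and g :: "int poly"
  assumes p: "prime p" and g: "lead_coeff g = 1"
    and c: "Yv * c \<in> ideal_of [pCons [:p:] h', pCons g f']" (is "_ \<in> ?K")
  shows "c \<in> ideal_of [pCons [:p:] h', pCons g f']"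
proof -
  define h f P G where hf: "h = pCons [:p:] h'" "f = pCons g f'" "P = [:[:p:]:]" "G = [:g:]"
  have h: "P = h - Yv * h'" and f: "G = f - Yv * f'" by (simp_all add: hf)
  obtain \<alpha> \<beta> where ab: "Yv * c = \<alpha> * h + \<beta> * f" using c unfolding ideal_of_pair hf by auto
  \<comment> \<open>At \<open>Y = 0\<close> the combination becomes a relation between \<open>p\<close> and \<open>g\<close>.\<close>
  have "coeff (Yv * c) 0 = coeff (\<alpha> * h + \<beta> * f) 0" using ab by simp
  then have e0: "coeff \<alpha> 0 * [:p:] + coeff \<beta> 0 * g = 0" by (simp add: hf coeff_mult_0 mult.commute)
  then have "coeff \<beta> 0 * g = [:p:] * (- coeff \<alpha> 0)" by (simp add: add_eq_0_iff mult.commute)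
  then have "[:p:] dvd coeff \<beta> 0 * g" by (metis dvd_triv_left)
  moreover have "prime_elem [:p:]" unfolding prime_elem_const_poly_iff using p by (rule prime_imp_prime_elem)
  moreover have "\<not> [:p:] dvd g"
  proof
    assume "[:p:] dvd g"
    then have "p dvd lead_coeff g" unfolding const_poly_dvd_iff by blast
    then show False using g p not_prime_unit[of p] by simp
  qed
  ultimately have "[:p:] dvd coeff \<beta> 0" using prime_elem_dvd_mult_iff by blast
  then obtain \<gamma> where \<gamma>: "coeff \<beta> 0 = [:p:] * \<gamma>" by (rule dvdE)
  have "[:p:] * (coeff \<alpha> 0 + \<gamma> * g) = 0" using e0 \<gamma> by (simp add: algebra_simps)
  moreover have "[:p:] \<noteq> 0" using p by auto
  ultimately have \<alpha>0: "coeff \<alpha> 0 = - (\<gamma> * g)" by (metis mult_eq_0_iff eq_neg_iff_add_eq_0)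
  obtain \<alpha>' \<beta>' where a': "\<alpha> = [:coeff \<alpha> 0:] + Yv * \<alpha>'" and b': "\<beta> = [:coeff \<beta> 0:] + Yv * \<beta>'"
    by (cases \<alpha>, cases \<beta>) simp
  have "[:coeff \<alpha> 0:] = - ([:\<gamma>:] * G)" "[:coeff \<beta> 0:] = P * [:\<gamma>:]"
    by (simp_all add: \<alpha>0 \<gamma> hf)
  then have a: "\<alpha> = - ([:\<gamma>:] * G) + Yv * \<alpha>'" and b: "\<beta> = P * [:\<gamma>:] + Yv * \<beta>'" using a' b' by simp_all
  \<comment> \<open>The constant parts of \<open>\<alpha>\<close> and \<open>\<beta>\<close> contribute
    \<open>\<gamma> (P f - G h) = \<gamma> ((h - Y h') f - (f - Y f') h) = \<gamma> Y (f' h - h' f)\<close>, again a multiple of \<open>Y\<close>.\<close>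
  define C Y where "C = [:\<gamma>:]" and Y: "Y = Yv"
  note ab' = ab[unfolded a b, folded C_def Y]
  have "Y * c = Y * ((C * f' + \<alpha>') * h + (\<beta>' - C * h') * f)"
    unfolding ab' h[folded Y] f[folded Y] by (simp add: algebra_simps)
  then have "c = (C * f' + \<alpha>') * h + (\<beta>' - C * h') * f" by (simp add: Y)
  then show ?thesis unfolding ideal_of_pair hf by auto
qed

lemma regular_pair_power:
  fixes p :: int and g :: "int poly"
  assumes p: "prime p" and g: "lead_coeff g = 1"
  shows "Yv ^ k * c \<in> ideal_of [pCons [:p:] h', pCons g f'] \<Longrightarrow> c \<in> ideal_of [pCons [:p:] h', pCons g f']"
proof (induction k)
  case (Suc k)
  then show ?case using regular_pair_commute[OF p g, of "Yv ^ k * c"] by (simp only: power_Suc mult.assoc)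
qed (simp only: power_0 mult_1_left)

context
  fixes I :: "int poly poly set" and p :: int and g :: "int poly"
  assumes I: "class_ideal I"
begin

text \<open>Units lift modulo a nilpotent ideal: the inverse of \<open>1 - z\<close> is the finite geometric series.\<close>

lemma unit_lift:
  assumes nil: "Yv ^ k \<in> I" and ab: "a * b - 1 - Yv * c \<in> I"
  shows "\<exists>b'. a * b' - 1 \<in> I"
proof -
  define z where "z = - (Yv * c)"
  have yc: "Yv * c = - z" by (simp add: z_def)
  let ?S = "\<Sum>i<k. z ^ i"
  have "z ^ k = Yv ^ k * (- c) ^ k" unfolding z_def by (metis mult_minus_right power_mult_distrib)
  then have zk: "z ^ k \<in> I" using class_idealD(4)[OF I nil] by simp
  have "(a * b - 1 - Yv * c) * ?S - z ^ k \<in> I"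
    by (rule class_idealD(6)[OF I class_idealD(4)[OF I ab] zk])
  also have "(a * b - 1 - Yv * c) * ?S - z ^ k = a * b * ?S - (1 - z) * ?S - z ^ k"
    unfolding yc by (simp add: algebra_simps)
  also have "(1 - z) * ?S = 1 - z ^ k" by (simp only: one_diff_power_eq)
  finally have "a * (b * ?S) - 1 \<in> I" by (simp add: mult.assoc)
  then show ?thesis by blast
qed

text \<open>
From here on \<open>p\<close> and \<open>g\<close> become multiples of \<open>Y\<close> modulo \<open>I\<close>, so that the residue ring modulo
\<open>Y\<close> and \<open>I\<close> is a quotient of \<open>\<int>[X]/(p, g)\<close> and elements have \<open>Y\<close>-adic expansions with digits as
coefficients.
\<close>

context
  fixes h' f'
  assumes p: "prime p" and g: "lead_coeff g = 1"
    and pY: "[:[:p:]:] - Yv * h' \<in> I" and gY: "[:g:] - Yv * f' \<in> I"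
begin

lemma const_mod_Y:
  assumes "a \<in> ideal_of [[:p:], g]"
  shows "\<exists>b. [:a:] - Yv * b \<in> I"
proof -
  obtain z q where a: "a = z * [:p:] + q * g" using assms unfolding ideal_of_pair by auto
  have "[:a:] = [:z:] * [:[:p:]:] + [:q:] * [:g:]" by (simp add: a)
  then have "[:a:] - Yv * ([:z:] * h' + [:q:] * f')
      = [:z:] * ([:[:p:]:] - Yv * h') + [:q:] * ([:g:] - Yv * f')" by (simp only: algebra_simps)
  also have "\<dots> \<in> I" by (intro class_idealD(2,3)[OF I] pY gY)
  finally show ?thesis by blast
qed

lemma digit_mod_Y: "\<exists>w\<in>digits p (degree g). \<exists>b. a - [:w:] - Yv * b \<in> I"
proof -
  obtain a0 a' where a: "a = [:a0:] + Yv * a'" by (cases a) simp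
  obtain w where w: "w \<in> digits p (degree g)" "a0 - w \<in> ideal_of [[:p:], g]"
    using digits_representative[OF _ g] prime_gt_0_int[OF p] by blast
  obtain b where "[:a0 - w:] - Yv * b \<in> I" using const_mod_Y[OF w(2)] by blast
  moreover have "a - [:w:] - Yv * (b + a') = [:a0 - w:] - Yv * b" by (simp add: a)
  ultimately show ?thesis using w(1) by metis
qed

lemma digit_expansion:
  "\<exists>w b. (\<forall>i. w i \<in> digits p (degree g)) \<and> a - (\<Sum>i<k. Polynomial.monom (w i) i) - Yv ^ k * b \<in> I"
proof (induction k)
  case 0
  have "0 \<in> digits p (degree g)" using prime_gt_0_int[OF p] by (rule zero_in_digits)
  then show ?case using class_idealD(1)[OF I] by (intro exI[of _ "\<lambda>_. 0"] exI[of _ a]) simp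
next
  case (Suc k)
  then obtain w b where w: "\<forall>i. w i \<in> digits p (degree g)"
    and b: "a - (\<Sum>i<k. Polynomial.monom (w i) i) - Yv ^ k * b \<in> I" by blast
  obtain x c where x: "x \<in> digits p (degree g)" and c: "b - [:x:] - Yv * c \<in> I"
    using digit_mod_Y by blast
  have "(\<Sum>i<Suc k. Polynomial.monom ((w(k := x)) i) i) = (\<Sum>i<k. Polynomial.monom (w i) i) + [:x:] * Yv ^ k"
    unfolding sum.lessThan_Suc monom_eq_Y_power[symmetric] fun_upd_same
    by (intro arg_cong2[of _ _ _ _ "(+)"] sum.cong refl) auto
  then have "a - (\<Sum>i<Suc k. Polynomial.monom ((w(k := x)) i) i) - Yv ^ Suc k * c
      = (a - (\<Sum>i<k. Polynomial.monom (w i) i) - Yv ^ k * b) + Yv ^ k * (b - [:x:] - Yv * c)"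
    by (simp only: power_Suc algebra_simps)
  also have "\<dots> \<in> I" by (rule class_idealD(2)[OF I b class_idealD(3)[OF I c]])
  finally have "a - (\<Sum>i<Suc k. Polynomial.monom ((w(k := x)) i) i) - Yv ^ Suc k * c \<in> I" .
  moreover have "\<forall>i. (w(k := x)) i \<in> digits p (degree g)" using w x by simp
  ultimately show ?case by blast
qed

lemma digit_expansion_nilpotent:
  assumes nil: "Yv ^ k \<in> I"
  shows "\<exists>w. (\<forall>i. w i \<in> digits p (degree g)) \<and> a - (\<Sum>i<k. Polynomial.monom (w i) i) \<in> I"
proof -
  obtain w b where w: "\<forall>i. w i \<in> digits p (degree g)"
    and b: "a - (\<Sum>i<k. Polynomial.monom (w i) i) - Yv ^ k * b \<in> I" using digit_expansion by blast
  have "(a - (\<Sum>i<k. Polynomial.monom (w i) i) - Yv ^ k * b) + Yv ^ k * b \<in> I"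
    by (rule class_idealD(2)[OF I b class_idealD(4)[OF I nil]])
  then show ?thesis using w by auto
qed

lemma finite_representatives:
  assumes nil: "Yv ^ k \<in> I"
  shows "\<exists>F. finite F \<and> (\<forall>a. \<exists>b\<in>F. a - b \<in> I)"
proof -
  let ?W = "PiE {..<k} (\<lambda>_. digits p (degree g))"
  let ?F = "(\<lambda>w. \<Sum>i<k. Polynomial.monom (w i) i) ` ?W"
  have fin: "finite ?F" by (intro finite_imageI finite_PiE) (auto simp: finite_digits)
  have all: "\<exists>b\<in>?F. a - b \<in> I" for a
  proof -
    obtain w where w: "\<forall>i. w i \<in> digits p (degree g)" "a - (\<Sum>i<k. Polynomial.monom (w i) i) \<in> I"
      using digit_expansion_nilpotent[OF nil] by blast
    have W: "restrict w {..<k} \<in> ?W" using w(1) by auto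
    have "(\<Sum>i<k. Polynomial.monom (restrict w {..<k} i) i) = (\<Sum>i<k. Polynomial.monom (w i) i)"
      by (intro sum.cong) auto
    then have "(\<Sum>i<k. Polynomial.monom (w i) i) \<in> ?F" by (rule image_eqI[OF sym W])
    then show ?thesis using w(2) by (intro bexI)
  qed
  show ?thesis by (rule exI[of _ ?F], rule conjI[OF fin], rule allI, rule all)
qed

text \<open>A constant term outside \<open>(p, g)\<close> is invertible in the field \<open>\<int>[X]/(p, g)\<close>, hence modulo \<open>Y\<close>, and
this lifts along the nilpotent \<open>Y\<close>.\<close>

lemma unit_if_const_unit:
  assumes irr: "irreducible_mod p g" and nil: "Yv ^ k \<in> I" and w: "w \<notin> ideal_of [[:p:], g]"
  shows "\<exists>b'. ([:w:] + Yv * c) * b' - 1 \<in> I"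
proof -
  obtain x y where xy: "1 = x * w + y" "y \<in> ideal_of [[:p:], g]"
    using maximal_if_irreducible_mod[OF p g irr w] unfolding ideal_of.simps(2)[of w] by blast
  obtain d where "[:y:] - Yv * d \<in> I" using const_mod_Y[OF xy(2)] by blast
  then have "- ([:y:] - Yv * d) \<in> I" by (rule class_idealD(5)[OF I])
  moreover have "1 = [:x:] * [:w:] + [:y:]" using xy(1) by (simp add: one_pCons)
  then have "([:w:] + Yv * c) * [:x:] - 1 - Yv * (c * [:x:] - d) = - ([:y:] - Yv * d)"
    by (simp only: algebra_simps)
  ultimately have "([:w:] + Yv * c) * [:x:] - 1 - Yv * (c * [:x:] - d) \<in> I" by (simp only:)
  then show ?thesis by (rule unit_lift[OF nil])
qed

end
end

section \<open>The ring given by a presentation\<close>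

lemma sum_monom_positive:
  assumes "\<And>i. i \<in> A \<Longrightarrow> 1 \<le> t i"
  shows "\<exists>b. (\<Sum>i\<in>A. Polynomial.monom (u i) (t i)) = Yv * b"
proof -
  have "Polynomial.monom (u i) (t i) = Yv * Polynomial.monom (u i) (t i - 1)" if "i \<in> A" for i
    using assms[OF that] by (cases "t i") (auto simp: monom_Suc)
  then have "(\<Sum>i\<in>A. Polynomial.monom (u i) (t i)) = Yv * (\<Sum>i\<in>A. Polynomial.monom (u i) (t i - 1))"
    unfolding sum_distrib_left by (intro sum.cong refl)
  then show ?thesis by blast
qed

lemma power_diff_in_class_ideal:
  assumes I: "class_ideal I" and ab: "a - b \<in> I"
  shows "a ^ k - b ^ k \<in> I"
  unfolding diff_power_eq_sum[of a] using class_idealD(4)[OF I ab]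
  by (cases k) (auto simp: class_idealD(1)[OF I] diff_power_eq_sum simp del: power_Suc)

text \<open>Cancellation of a power of an element that is invertible modulo \<open>I\<close>.\<close>

lemma product_one_power_in_class_ideal:
  assumes I: "class_ideal I" and ab: "a * b - 1 \<in> I" and ak: "c * a ^ k \<in> I"
  shows "c \<in> I"
proof -
  have "(a * b) ^ k - 1 ^ k \<in> I" by (rule power_diff_in_class_ideal[OF I ab])
  then have "c * a ^ k * b ^ k - c * ((a * b) ^ k - 1 ^ k) \<in> I"
    by (intro class_idealD(6)[OF I class_idealD(4)[OF I ak] class_idealD(3)[OF I]])
  then show ?thesis by (simp add: power_mult_distrib algebra_simps)
qed

text \<open>The data of the theorem with integer polynomials in place of residue-class polynomials.  The
condition on \<open>u\<^sub>1\<close> makes \<open>p\<close> a unit times \<open>Y\<close> to the power \<open>t\<^sub>1\<close>.\<close>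

locale chain_presentation =
  fixes p :: int and r s n m :: nat and g :: "int poly" and u v :: "nat \<Rightarrow> int poly"
    and t e :: "nat \<Rightarrow> nat"
  assumes p: "prime p" and g: "lead_coeff g = 1" and irr: "irreducible_mod p g"
    and n: "n \<ge> 1" and u: "u 1 \<notin> ideal_of [[:p:], g]"
    and t1: "1 \<le> t 1" "t 1 \<le> s" and t_mono: "strict_mono_on {1..n} t"
    and e_pos: "\<And>j. j \<in> {1..m} \<Longrightarrow> 1 \<le> e j"
    and lower: "(r - 1) * t 1 \<le> s" and upper: "s < r * t 1"
begin

abbreviation "Q \<equiv> Q_ideal p r s n m g u v t e"
abbreviation "pc \<equiv> [:[:p:]:] :: int poly poly"

lemma Q: "class_ideal Q"
  unfolding Q_ideal_def by (rule class_ideal_ideal_of)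

lemma Q_gens: "pc ^ r \<in> Q" "pc * Yv ^ (s + 1 - t 1) \<in> Q" "Yv ^ (s + 1) \<in> Q" "p_rel p n u t \<in> Q"
    "g_rel g m v e \<in> Q"
  using generators_in_ideal_of[of "[[:[:p:]:] ^ r, [:[:p:]:] * Yv ^ (s + 1 - t 1), Yv ^ (s + 1),
    p_rel p n u t, g_rel g m v e]"] unfolding Q_ideal_def list.set by blast+

lemma p_rel_eq: "\<exists>b. p_rel p n u t = pc - Yv ^ t 1 * ([:u 1:] + Yv * b)"
proof -
  have "t 1 < t i" if "i \<in> {1..n}" "i \<noteq> 1" for i
    using that t_mono n by (auto simp: strict_mono_on_def)
  then show ?thesis unfolding p_rel_def
    using sum_monom_lowest[of "{1..n}" 1 t u] n by auto
qed

lemma g_rel_eq: "\<exists>b. g_rel g m v e = [:g:] - Yv * b"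
  unfolding g_rel_def using sum_monom_positive[of "{1..m}" e v] e_pos by auto

text \<open>The heart of the converse direction: the relations do not make the chain of ideals shorter than
announced.  Let \<open>K\<close> be the ideal of the last two relations.  Modulo \<open>K\<close> the element \<open>p\<close> equals
\<open>Y\<close> to the power \<open>t\<^sub>1\<close> times \<open>w\<close>, so the other three generators become multiples of \<open>Y\<^sup>s\<^sup>+\<^sup>1\<close>; this is
where \<open>s < r t\<^sub>1\<close> enters.  If \<open>Y\<^sup>s\<close> were in \<open>Q\<close>, then \<open>Y\<^sup>s (1 - Y c)\<close> would lie in \<open>K\<close>, and
so would \<open>1 - Y c\<close>, as \<open>Y\<close> is a nonzerodivisor modulo \<open>K\<close>.  At \<open>Y = 0\<close> this says that \<open>g\<close> is a
unit modulo \<open>p\<close>.\<close>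

lemma Y_power_notin: "Yv ^ s \<notin> Q"
proof
  assume "Yv ^ s \<in> Q"
  obtain b where h: "p_rel p n u t = pc - Yv ^ t 1 * ([:u 1:] + Yv * b)" using p_rel_eq by blast
  obtain d where f: "g_rel g m v e = [:g:] - Yv * d" using g_rel_eq by blast
  define w where "w = [:u 1:] + Yv * b"
  define K where "K = ideal_of [p_rel p n u t, g_rel g m v e]"
  have K: "class_ideal K" unfolding K_def by (rule class_ideal_ideal_of)
  note D = class_idealD[OF K]
  have hK: "p_rel p n u t \<in> K" using generators_in_ideal_of unfolding K_def by fastforce
  have "p_rel p n u t = pCons [:p:] (- (Yv ^ (t 1 - 1) * w))"
    unfolding h w_def[symmetric] pCons_eq_Y[of _ "- _"] using t1(1)
    by (cases "t 1") (simp_all add: mult.assoc)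
  moreover have "g_rel g m v e = pCons g (- d)" unfolding f by simp
  ultimately have K': "K = ideal_of [pCons [:p:] (- (Yv ^ (t 1 - 1) * w)), pCons g (- d)]"
    unfolding K_def by simp
  have pw: "pc - Yv ^ t 1 * w \<in> K" using hK unfolding h w_def .
  obtain x1 x2 x3 z where eq: "Yv ^ s = x1 * pc ^ r + (x2 * (pc * Yv ^ (s + 1 - t 1)) + (x3 * Yv ^ (s + 1) + z))"
    and z: "z \<in> K"
    using \<open>Yv ^ s \<in> Q\<close> unfolding Q_ideal_def K_def ideal_of.simps(2)[of "[:[:p:]:] ^ r"]
      ideal_of.simps(2)[of "[:[:p:]:] * Yv ^ (s + 1 - t 1)"] ideal_of.simps(2)[of "Yv ^ (s + 1)"] by blast
  have 1: "pc ^ r - Yv ^ (s + 1) * (Yv ^ (r * t 1 - (s + 1)) * w ^ r) \<in> K"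
  proof -
    have "(Yv ^ t 1 * w) ^ r = Yv ^ (r * t 1) * w ^ r" by (simp only: power_mult_distrib power_mult[symmetric] mult.commute)
    also have "r * t 1 = (s + 1) + (r * t 1 - (s + 1))" using upper by simp
    also have "Yv ^ \<dots> = Yv ^ (s + 1) * Yv ^ (r * t 1 - (s + 1))" by (rule power_add)
    finally have "Yv ^ (s + 1) * (Yv ^ (r * t 1 - (s + 1)) * w ^ r) = (Yv ^ t 1 * w) ^ r" by (simp only: mult.assoc)
    then show ?thesis using power_diff_in_class_ideal[OF K pw, of r] by (simp only:)
  qed
  have 2: "pc * Yv ^ (s + 1 - t 1) - Yv ^ (s + 1) * w \<in> K"
  proof -
    have "t 1 + (s + 1 - t 1) = s + 1" using t1 by simp
    then have "Yv ^ (s + 1) = Yv ^ t 1 * Yv ^ (s + 1 - t 1)" by (simp only: power_add[symmetric])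
    then have "pc * Yv ^ (s + 1 - t 1) - Yv ^ (s + 1) * w = (pc - Yv ^ t 1 * w) * Yv ^ (s + 1 - t 1)"
      by (simp only: algebra_simps)
    then show ?thesis using D(4)[OF pw] by (simp only:)
  qed
  define c where "c = x1 * (Yv ^ (r * t 1 - (s + 1)) * w ^ r) + x2 * w + x3"
  have "x1 * (pc ^ r - Yv ^ (s + 1) * (Yv ^ (r * t 1 - (s + 1)) * w ^ r))
      + (x2 * (pc * Yv ^ (s + 1 - t 1) - Yv ^ (s + 1) * w) + z) \<in> K"
    by (intro D(2) D(3) 1 2 z)
  also have "x1 * (pc ^ r - Yv ^ (s + 1) * (Yv ^ (r * t 1 - (s + 1)) * w ^ r))
      + (x2 * (pc * Yv ^ (s + 1 - t 1) - Yv ^ (s + 1) * w) + z) = Yv ^ s - Yv ^ (s + 1) * c"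
    unfolding eq c_def by (simp only: algebra_simps)
  also have "Yv ^ s - Yv ^ (s + 1) * c = Yv ^ s * (1 - Yv * c)"
    by (simp only: power_add power_one_right algebra_simps)
  finally have "1 - Yv * c \<in> K" unfolding K' by (rule regular_pair_power[OF p g])
  then obtain \<alpha> \<beta> where "1 - Yv * c = \<alpha> * p_rel p n u t + \<beta> * g_rel g m v e"
    unfolding K_def ideal_of_pair by auto
  then have "coeff (1 - Yv * c) 0 = coeff (\<alpha> * p_rel p n u t + \<beta> * g_rel g m v e) 0" by simp
  moreover have "coeff (p_rel p n u t) 0 = [:p:]" unfolding h using t1 by (simp add: coeff_mult_0 coeff_0_power)
  moreover have "coeff (g_rel g m v e) 0 = g" unfolding f by simp
  ultimately have "1 = coeff \<alpha> 0 * [:p:] + coeff \<beta> 0 * g" by (simp add: coeff_mult_0)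
  then have "g * coeff \<beta> 0 - 1 = [:p:] * (- coeff \<alpha> 0)" by (simp add: algebra_simps)
  then have "unit_mod p g" unfolding unit_mod_def by (metis dvd_triv_left)
  then show False using irr unfolding irreducible_mod_def by blast
qed

lemma p_mod_Y: "\<exists>b. pc - Yv * b \<in> Q"
proof -
  obtain b where b: "p_rel p n u t = pc - Yv ^ t 1 * ([:u 1:] + Yv * b)" using p_rel_eq by blast
  have "Yv ^ t 1 = Yv * Yv ^ (t 1 - 1)" using t1(1) by (simp flip: power_Suc)
  then have "p_rel p n u t = pc - Yv * (Yv ^ (t 1 - 1) * ([:u 1:] + Yv * b))" using b by (simp only: mult.assoc)
  then show ?thesis using Q_gens(4) by metis
qed

lemma g_mod_Y: "\<exists>b. [:g:] - Yv * b \<in> Q"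
  using g_rel_eq Q_gens(5) by metis

lemma Q_unit_or_multiple: "(\<exists>b. a * b - 1 \<in> Q) \<or> (\<exists>b. a - Yv * b \<in> Q)"
proof -
  obtain h' f' where h: "pc - Yv * h' \<in> Q" and f: "[:g:] - Yv * f' \<in> Q" using p_mod_Y g_mod_Y by blast
  obtain w b where w: "w \<in> digits p (degree g)" and b: "a - [:w:] - Yv * b \<in> Q"
    using digit_mod_Y[OF Q p g h f] by blast
  show ?thesis
  proof (cases "w \<in> ideal_of [[:p:], g]")
    case True
    then obtain c where "[:w:] - Yv * c \<in> Q" using const_mod_Y[OF Q p g h f] by blast
    then have "(a - [:w:] - Yv * b) + ([:w:] - Yv * c) \<in> Q" by (rule class_idealD(2)[OF Q b])
    also have "(a - [:w:] - Yv * b) + ([:w:] - Yv * c) = a - Yv * (b + c)" by (simp only: algebra_simps)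
    finally show ?thesis by blast
  next
    case False
    obtain b' where b': "([:w:] + Yv * b) * b' - 1 \<in> Q"
      using unit_if_const_unit[OF Q p g h f irr Q_gens(3) False] by blast
    have "(a - [:w:] - Yv * b) * b' + (([:w:] + Yv * b) * b' - 1) \<in> Q"
      by (rule class_idealD(2)[OF Q class_idealD(4)[OF Q b] b'])
    also have "(a - [:w:] - Yv * b) * b' + (([:w:] + Yv * b) * b' - 1) = a * b' - 1"
      by (simp only: algebra_simps)
    finally show ?thesis by blast
  qed
qed

text \<open>Modulo \<open>Q\<close>, \<open>p\<^sup>r\<^sup>-\<^sup>1\<close> is a unit times \<open>Y\<close> to the power \<open>(r - 1) t\<^sub>1 \<le> s\<close>, hence a divisor of the nonzero
element \<open>Y\<^sup>s\<close>.\<close>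

lemma p_power_notin: "pc ^ (r - 1) \<notin> Q"
proof
  assume a: "pc ^ (r - 1) \<in> Q"
  obtain h' f' where hf: "pc - Yv * h' \<in> Q" "[:g:] - Yv * f' \<in> Q" using p_mod_Y g_mod_Y by blast
  obtain b where b: "p_rel p n u t = pc - Yv ^ t 1 * ([:u 1:] + Yv * b)" using p_rel_eq by blast
  let ?w = "[:u 1:] + Yv * b"
  obtain b' where b': "?w * b' - 1 \<in> Q"
    using unit_if_const_unit[OF Q p g hf irr Q_gens(3) u] by blast
  have "pc - Yv ^ t 1 * ?w \<in> Q" using Q_gens(4) b by simp
  then have "pc ^ (r - 1) - (Yv ^ t 1 * ?w) ^ (r - 1) \<in> Q" by (rule power_diff_in_class_ideal[OF Q])
  then have "pc ^ (r - 1) - (pc ^ (r - 1) - (Yv ^ t 1 * ?w) ^ (r - 1)) \<in> Q" by (rule class_idealD(6)[OF Q a])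
  then have "Yv ^ (t 1 * (r - 1)) * ?w ^ (r - 1) \<in> Q" by (simp only: power_mult_distrib power_mult diff_diff_eq2 add_diff_cancel_left')
  then have "Yv ^ (t 1 * (r - 1)) \<in> Q" by (rule product_one_power_in_class_ideal[OF Q b'])
  then have "Yv ^ (t 1 * (r - 1)) * Yv ^ (s - t 1 * (r - 1)) \<in> Q" by (rule class_idealD(4)[OF Q])
  moreover have "t 1 * (r - 1) + (s - t 1 * (r - 1)) = s" using lower by (simp add: mult.commute)
  ultimately show False using Y_power_notin by (simp only: power_add[symmetric])
qed

lemma Q_finite_representatives: "\<exists>F. finite F \<and> (\<forall>a. \<exists>b\<in>F. a - b \<in> Q)"
  using finite_representatives[OF Q p g _ _ Q_gens(3)] p_mod_Y g_mod_Y by blast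

end

section \<open>A presentation from the ideal of relations\<close>

lemma strict_enumeration:
  fixes T :: "nat set"
  assumes "finite T"
  obtains n :: nat and t where "strict_mono_on {1..n} t" "bij_betw t {1..n} T"
proof -
  obtain h where h: "bij_betw h {..<card T} T" "strict_mono_on {..<card T} h"
    using ex_bij_betw_strict_mono_card[OF assms] by blast
  have "bij_betw (\<lambda>i. i - 1) {1..card T} {..<card T}"
    by (rule bij_betwI[where g = Suc]) auto
  then have "bij_betw (\<lambda>i. h (i - 1)) {1..card T} T"
    using bij_betw_trans[OF _ h(1)] unfolding comp_def by blast
  moreover have "strict_mono_on {1..card T} (\<lambda>i. h (i - 1))"
    using h(2) unfolding strict_mono_on_def by (simp add: less_diff_conv2)
  ultimately show thesis using that by blast
qed

text \<open>The ideal \<open>I\<close> stands for the kernel of a surjection from \<open>\<int>[X][Y]\<close> onto a finite chain ring of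
characteristic \<open>p\<^sup>r\<close> that sends \<open>Y\<close> to a uniformizer.  The monic polynomial in \<open>I\<close> exists because the
powers of the image of \<open>X\<close> repeat.\<close>

locale chain_ideal =
  fixes I :: "int poly poly set" and p :: int and r s :: nat
  assumes I: "class_ideal I" and p: "prime p"
    and nil: "Yv ^ Suc s \<in> I" and nonzero: "Yv ^ s \<notin> I"
    and unit_or_multiple: "\<And>a. (\<exists>b. a * b - 1 \<in> I) \<or> (\<exists>b. a - Yv * b \<in> I)"
    and pr: "[:[:p:]:] ^ r \<in> I" and pr1: "[:[:p:]:] ^ (r - 1) \<notin> I" and r: "r \<ge> 2"
    and monic: "\<exists>f. lead_coeff f = 1 \<and> [:f:] \<in> I"
begin

abbreviation "pc \<equiv> [:[:p:]:] :: int poly poly"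

lemma one_notin: "1 \<notin> I"
  using nonzero class_idealD(3)[OF I, of 1 "Yv ^ s"] by auto

lemma Y_power_in_iff: "Yv ^ k \<in> I \<longleftrightarrow> s < k"
proof -
  have "Yv ^ j \<in> I" if "i \<le> j" "Yv ^ i \<in> I" for i j
    using class_idealD(4)[OF I that(2), of "Yv ^ (j - i)"] that(1) by (simp only: power_add[symmetric] le_add_diff_inverse)
  then show ?thesis using nil nonzero by (meson Suc_leI not_le)
qed

text \<open>The preimage of the maximal ideal, that is \<open>(Y) + I\<close>.\<close>

definition M :: "int poly poly set" where "M = {a. \<exists>b. a - Yv * b \<in> I}"

lemma M: "class_ideal M"
proof -
  have "a + a' \<in> M" if aa: "a \<in> M" "a' \<in> M" for a a'
  proof -
    obtain b b' where "a - Yv * b \<in> I" "a' - Yv * b' \<in> I" using aa unfolding M_def by blast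
    then have "(a - Yv * b) + (a' - Yv * b') \<in> I" by (rule class_idealD(2)[OF I])
    also have "(a - Yv * b) + (a' - Yv * b') = (a + a') - Yv * (b + b')" by (simp only: algebra_simps)
    finally show ?thesis unfolding M_def by blast
  qed
  moreover have "c * a \<in> M" if aM: "a \<in> M" for a c
  proof -
    obtain b where "a - Yv * b \<in> I" using aM unfolding M_def by blast
    then have "c * (a - Yv * b) \<in> I" by (rule class_idealD(3)[OF I])
    also have "c * (a - Yv * b) = c * a - Yv * (c * b)" by (simp only: algebra_simps)
    finally show ?thesis unfolding M_def by blast
  qed
  moreover have "0 \<in> M" unfolding M_def using class_idealD(1)[OF I] by (auto intro!: exI[of _ 0])
  ultimately show ?thesis unfolding class_ideal_def by blast
qed

lemma I_subset_M: "a \<in> I \<Longrightarrow> a \<in> M"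
  unfolding M_def by (auto intro!: exI[of _ 0])

lemma Y_mult_in_M: "Yv * b \<in> M"
  unfolding M_def using class_idealD(1)[OF I] by (auto intro!: exI[of _ b])

lemma M_nilpotent: "a \<in> M \<Longrightarrow> a ^ Suc s \<in> I"
proof -
  assume "a \<in> M"
  then obtain b where "a - Yv * b \<in> I" unfolding M_def by blast
  then have "a ^ Suc s - (Yv * b) ^ Suc s \<in> I" by (rule power_diff_in_class_ideal[OF I])
  moreover have "(Yv * b) ^ Suc s \<in> I"
    unfolding power_mult_distrib by (rule class_idealD(4)[OF I nil])
  ultimately have "(a ^ Suc s - (Yv * b) ^ Suc s) + (Yv * b) ^ Suc s \<in> I" by (rule class_idealD(2)[OF I])
  then show ?thesis by (simp only: diff_add_cancel)
qed

lemma one_notin_M: "1 \<notin> M"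
  using M_nilpotent[of 1] one_notin by (simp only: power_one not_False_eq_True) blast

lemma unit_iff: "a \<notin> M \<longleftrightarrow> (\<exists>b. a * b - 1 \<in> I)"
proof
  assume "a \<notin> M"
  then show "\<exists>b. a * b - 1 \<in> I" using unit_or_multiple[of a] unfolding M_def by blast
next
  assume "\<exists>b. a * b - 1 \<in> I"
  then obtain b where b: "a * b - 1 \<in> M" using I_subset_M by blast
  show "a \<notin> M"
  proof
    assume "a \<in> M"
    then have "a * b - (a * b - 1) \<in> M" by (rule class_idealD(6)[OF M class_idealD(4)[OF M] b])
    then show False using one_notin_M by simp
  qed
qed

lemma M_prime: "a * b \<in> M \<Longrightarrow> a \<in> M \<or> b \<in> M"
proof (rule ccontr)
  assume ab: "a * b \<in> M" and "\<not> (a \<in> M \<or> b \<in> M)"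
  then obtain a' where a': "a * a' - 1 \<in> M" and b: "b \<notin> M" using unit_iff I_subset_M by blast
  have "a * b * a' - b * (a * a' - 1) \<in> M"
    by (rule class_idealD(6)[OF M class_idealD(4)[OF M ab] class_idealD(3)[OF M a']])
  then show False using b by (simp add: algebra_simps)
qed

lemma p_in_M: "pc \<in> M"
proof (rule ccontr)
  assume "pc \<notin> M"
  then obtain b where "pc * b - 1 \<in> I" using unit_iff by blast
  moreover have "1 * pc ^ r \<in> I" using pr by simp
  ultimately show False using product_one_power_in_class_ideal[OF I] one_notin by blast
qed

text \<open>The kernel of \<open>\<int>[X]\<close> onto the residue field.\<close>

definition N :: "int poly set" where "N = {a. [:a:] \<in> M}"

lemma N: "class_ideal N"
proof -
  have "[:a + b:] \<in> M" if "[:a:] \<in> M" "[:b:] \<in> M" for a b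
    using class_idealD(2)[OF M that] by simp
  moreover have "[:c * a:] \<in> M" if "[:a:] \<in> M" for a c
    using class_idealD(3)[OF M that, of "[:c:]"] by (simp add: mult.commute)
  moreover have "[:0:] \<in> M" using class_idealD(1)[OF M] by simp
  ultimately show ?thesis unfolding N_def class_ideal_def by blast
qed

text \<open>The polynomial \<open>g\<close> lifts the minimal polynomial over \<open>\<int>\<^sub>p\<close> of the residue of \<open>X\<close>; its irreducibility
comes from the primality of the maximal ideal.  By minimality of its degree no nonzero digit lies
in \<open>N\<close>.\<close>

lemma residue_minimal_polynomial:
  obtains g where "lead_coeff g = 1" "irreducible_mod p g" "g \<in> N" "degree g > 0"
    and "\<And>w. w \<in> digits p (degree g) \<Longrightarrow> w \<in> N \<Longrightarrow> w = 0"
proof -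
  have pN: "[:p:] \<in> N" using p_in_M unfolding N_def by simp
  obtain f where f: "lead_coeff f = 1" "f \<in> N" using monic I_subset_M unfolding N_def by blast
  obtain g where g: "g \<in> N" "lead_coeff g = 1"
    and low: "\<And>j. j \<in> N \<Longrightarrow> \<not> [:p:] dvd j \<Longrightarrow> degree g \<le> degree j"
    and mult: "\<And>j. j \<in> N \<Longrightarrow> \<exists>q. [:p:] dvd j - g * q"
    using ideal_over_prime_monic_generator[OF p N pN f(2,1)] by metis
  have one: "1 \<notin> N" using one_notin_M unfolding N_def by (simp add: one_pCons)
  have ng: "\<not> [:p:] dvd g"
  proof
    assume "[:p:] dvd g"
    then have "p dvd lead_coeff g" unfolding const_poly_dvd_iff by blast
    then show False using g p not_prime_unit[of p] by simp
  qed
  \<comment> \<open>If the factor \<open>a\<close> of \<open>g\<close> lies in \<open>N\<close>, then \<open>g\<close> divides \<open>a\<close> modulo \<open>p\<close>, and cancelling \<open>g\<close>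
    leaves a unit \<open>b\<close>.\<close>
  have split: "unit_mod p b" if ab: "[:p:] dvd g - a * b" and a: "a \<in> N" for a b
  proof -
    obtain q where "[:p:] dvd a - g * q" using mult[OF a] by blast
    then have "[:p:] dvd (g - a * b) + (a - g * q) * b" using ab by (intro dvd_add dvd_mult2)
    also have "(g - a * b) + (a - g * q) * b = g * (1 - q * b)" by (simp only: algebra_simps)
    finally have "[:p:] dvd g * (1 - q * b)" .
    moreover have "prime_elem [:p:]" unfolding prime_elem_const_poly_iff using p by (rule prime_imp_prime_elem)
    ultimately have "[:p:] dvd 1 - q * b" using ng prime_elem_dvd_mult_iff by blast
    then have "[:p:] dvd b * q - 1" by (subst dvd_minus_iff[symmetric]) (simp add: mult.commute)
    then show ?thesis unfolding unit_mod_def by blast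
  qed
  have "irreducible_mod p g" unfolding irreducible_mod_def
  proof (intro conjI allI impI)
    show "\<not> [:p:] dvd g" by (rule ng)
    show "\<not> unit_mod p g"
    proof
      assume "unit_mod p g"
      then obtain b where "[:p:] dvd g * b - 1" unfolding unit_mod_def by blast
      then have "g * b - 1 \<in> N" by (rule dvd_in_class_ideal[OF N pN])
      then have "g * b - (g * b - 1) \<in> N" by (rule class_idealD(6)[OF N class_idealD(4)[OF N g(1)]])
      then show False using one by simp
    qed
    fix a b assume ab: "[:p:] dvd g - a * b"
    then have "g - a * b \<in> N" by (rule dvd_in_class_ideal[OF N pN])
    then have "g - (g - a * b) \<in> N" by (rule class_idealD(6)[OF N g(1)])
    then have "[:a:] * [:b:] \<in> M" unfolding N_def by (simp add: mult.commute)
    then have "a \<in> N \<or> b \<in> N" using M_prime unfolding N_def by blast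
    then show "unit_mod p a \<or> unit_mod p b" using split[of a b] split[of b a] ab by (metis mult.commute)
  qed
  moreover have d: "degree g > 0"
  proof (rule ccontr)
    assume "\<not> degree g > 0"
    then have "g = 1" using g(2) by (auto elim!: degree_eq_zeroE)
    then show False using g one by simp
  qed
  moreover have "w = 0" if w: "w \<in> digits p (degree g)" "w \<in> N" for w
  proof (rule ccontr)
    assume "w \<noteq> 0"
    then have "\<not> [:p:] dvd w" using digits_eq_0 w by blast
    then show False using low w digits_degree[OF w(1) d] by fastforce
  qed
  ultimately show thesis using that g by blast
qed

text \<open>Digit expansions of zero modulo \<open>I\<close> are trivial: up to a unit, the lowest nonzero digit would
produce a power of \<open>Y\<close> in \<open>I\<close> with exponent at most \<open>s\<close>.\<close>

lemma digit_sum_unique: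
  assumes dig: "\<And>w. w \<in> D \<Longrightarrow> w \<in> N \<Longrightarrow> w = 0"
    and w: "\<forall>i. w i \<in> D" and sum: "(\<Sum>i<Suc s. Polynomial.monom (w i) i) \<in> I" and i: "i \<le> s"
  shows "w i = 0"
proof (rule ccontr)
  assume "w i \<noteq> 0"
  define T where "T = {i\<in>{..<Suc s}. w i \<noteq> 0}"
  have T: "finite T" "T \<noteq> {}" using \<open>w i \<noteq> 0\<close> i by (auto simp: T_def intro!: exI[of _ i])
  define k where "k = Min T"
  have k: "k \<in> T" "\<And>i. i \<in> T \<Longrightarrow> i \<noteq> k \<Longrightarrow> k < i"
    using T unfolding k_def by (auto intro: Min_in simp: order_less_le)
  have "(\<Sum>i\<in>T. Polynomial.monom (w i) i) = (\<Sum>i<Suc s. Polynomial.monom (w i) i)"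
    by (rule sum.mono_neutral_left) (auto simp: T_def)
  moreover obtain b where "(\<Sum>i\<in>T. Polynomial.monom (w i) i) = Yv ^ k * ([:w k:] + Yv * b)"
    using sum_monom_lowest[OF T(1) k(1), of "\<lambda>i. i" w] k(2) by auto
  ultimately have inI: "Yv ^ k * ([:w k:] + Yv * b) \<in> I" using sum by simp
  have "[:w k:] \<notin> M" using dig[of "w k"] w k(1) unfolding N_def T_def by blast
  then have "[:w k:] + Yv * b \<notin> M"
    using class_idealD(6)[OF M _ Y_mult_in_M[of b], of "[:w k:] + Yv * b"] by (metis add_diff_cancel_right')
  then obtain c where "([:w k:] + Yv * b) * c - 1 \<in> I" using unit_iff by blast
  then have "Yv ^ k \<in> I" using product_one_power_in_class_ideal[OF I, of _ c "Yv ^ k" 1] inI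
    by (metis power_one_right)
  then show False using k(1) Y_power_in_iff unfolding T_def by simp
qed

text \<open>The relations are read off from the digit expansions of \<open>p\<close> and of \<open>g\<close>, keeping the nonzero digits
only.  Both bounds on \<open>t\<^sub>1\<close> express that \<open>p\<close> has order \<open>t\<^sub>1\<close> at \<open>Y\<close> and that \<open>r\<close> is the exact
nilpotency index of \<open>p\<close>.  The relations generate \<open>I\<close>: modulo them every element has a digit expansion,
and for an element of \<open>I\<close> this expansion vanishes by uniqueness.\<close>

theorem presentation:
  obtains n m :: nat and g u v t e where
    "n \<ge> 1" "lead_coeff g = 1" "irreducible_mod p g" "degree g > 0"
    "\<And>i. i \<in> {1..n} \<Longrightarrow> u i \<in> digits p (degree g) \<and> u i \<notin> ideal_of [[:p:], g]"
    "\<And>j. j \<in> {1..m} \<Longrightarrow> v j \<in> digits p (degree g) \<and> v j \<notin> ideal_of [[:p:], g]"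
    "\<And>i. i \<in> {1..n} \<Longrightarrow> 1 \<le> t i \<and> t i \<le> s" "strict_mono_on {1..n} t"
    "\<And>j. j \<in> {1..m} \<Longrightarrow> 1 \<le> e j \<and> e j \<le> s" "strict_mono_on {1..m} e"
    "(r - 1) * t 1 \<le> s" "s < r * t 1"
    "I = Q_ideal p r s n m g u v t e"
proof -
  obtain g where g: "lead_coeff g = 1" "irreducible_mod p g" "g \<in> N" "degree g > 0"
    and dig: "\<And>w. w \<in> digits p (degree g) \<Longrightarrow> w \<in> N \<Longrightarrow> w = 0"
    using residue_minimal_polynomial by blast
  have GM: "[:g:] \<in> M" using g(3) unfolding N_def by simp
  obtain h' f' where hf: "pc - Yv * h' \<in> I" "[:g:] - Yv * f' \<in> I"
    using p_in_M GM unfolding M_def by blast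
  have pgN: "a \<in> N" if "a \<in> ideal_of [[:p:], g]" for a
    using ideal_of_minimal[OF N, of "[[:p:], g]"] that g(3) p_in_M unfolding N_def by auto
  have expand: "\<exists>(n::nat) w t. strict_mono_on {1..n} t \<and> (\<forall>i\<in>{1..n}. 1 \<le> t i \<and> t i \<le> s)
      \<and> (\<forall>i\<in>{1..n}. w i \<in> digits p (degree g) \<and> w i \<notin> ideal_of [[:p:], g])
      \<and> a - (\<Sum>i\<in>{1..n}. Polynomial.monom (w i) (t i)) \<in> I" if a: "a \<in> M" for a
  proof -
    obtain w where w: "\<forall>i. w i \<in> digits p (degree g)"
      and aw: "a - (\<Sum>i<Suc s. Polynomial.monom (w i) i) \<in> I"
      using digit_expansion_nilpotent[OF I p g(1) hf nil] by blast
    \<comment> \<open>The index \<open>0\<close> may be left out: the constant digit of an element of the maximal ideal vanishes.\<close>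
    define T where "T = {i\<in>{1..s}. w i \<noteq> 0}"
    have "finite T" by (simp add: T_def)
    then obtain n :: nat and t where nt: "strict_mono_on {1..n} t" "bij_betw t {1..n} T"
      by (rule strict_enumeration)
    have tT: "t i \<in> T" if "i \<in> {1..n}" for i using bij_betw_apply[OF nt(2) that] .
    have "(\<Sum>i<Suc s. Polynomial.monom (w i) i) = [:w 0:] + (\<Sum>i\<in>{1..s}. Polynomial.monom (w i) i)"
    proof -
      have "{..<Suc s} = insert 0 {1..s}" by auto
      then show ?thesis by (simp add: monom_0)
    qed
    moreover obtain b where b: "(\<Sum>i\<in>{1..s}. Polynomial.monom (w i) i) = Yv * b"
      using sum_monom_positive[of "{1..s}" "\<lambda>i. i" w] by auto
    ultimately have "a - ([:w 0:] + Yv * b) \<in> M" using I_subset_M[OF aw] by (simp only:)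
    then have "a - (a - ([:w 0:] + Yv * b)) - Yv * b \<in> M"
      by (rule class_idealD(6)[OF M class_idealD(6)[OF M a] Y_mult_in_M])
    then have "[:w 0:] \<in> M" by (simp only: diff_diff_eq2 add_diff_cancel_left' add_diff_cancel_right')
    then have w0: "w 0 = 0" using dig w unfolding N_def by blast
    have "(\<Sum>i\<in>{1..n}. Polynomial.monom (w (t i)) (t i)) = (\<Sum>i\<in>T. Polynomial.monom (w i) i)"
      by (rule sum.reindex_bij_betw[OF nt(2)])
    also have "\<dots> = (\<Sum>i<Suc s. Polynomial.monom (w i) i)"
      using w0 by (intro sum.mono_neutral_left) (auto simp: T_def Suc_le_eq intro!: Nat.gr0I)
    finally have "a - (\<Sum>i\<in>{1..n}. Polynomial.monom (w (t i)) (t i)) \<in> I" using aw by simp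
    moreover have "w (t i) \<notin> ideal_of [[:p:], g]" if "i \<in> {1..n}" for i
      using tT[OF that] dig pgN w unfolding T_def by blast
    moreover have "1 \<le> t i \<and> t i \<le> s" if "i \<in> {1..n}" for i using tT[OF that] unfolding T_def by simp
    ultimately show ?thesis using nt(1) w by (intro exI[of _ n] exI[of _ "\<lambda>i. w (t i)"] exI[of _ t]) auto
  qed
  obtain n u t where t: "strict_mono_on {1..n} t" "\<forall>i\<in>{1..n}. 1 \<le> t i \<and> t i \<le> s"
    and u: "\<forall>i\<in>{1..n}. u i \<in> digits p (degree g) \<and> u i \<notin> ideal_of [[:p:], g]"
    and hI: "p_rel p n u t \<in> I"
    using expand[OF p_in_M] unfolding p_rel_def by (elim exE conjE)
  obtain m v e where e: "strict_mono_on {1..m} e" "\<forall>j\<in>{1..m}. 1 \<le> e j \<and> e j \<le> s"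
    and v: "\<forall>j\<in>{1..m}. v j \<in> digits p (degree g) \<and> v j \<notin> ideal_of [[:p:], g]"
    and fI: "g_rel g m v e \<in> I"
    using expand[OF GM] unfolding g_rel_def by (elim exE conjE)
  have n: "n \<ge> 1"
  proof (rule ccontr)
    assume "\<not> n \<ge> 1"
    then have "pc \<in> I" using hI unfolding p_rel_def by simp
    then have "pc ^ (r - 2) * pc \<in> I" by (rule class_idealD(3)[OF I])
    moreover have "r - 1 = Suc (r - 2)" using r by simp
    ultimately show False using pr1 by (simp only: power_Suc2 simp_thms)
  qed
  have "t 1 < t i" if "i \<in> {1..n}" "i \<noteq> 1" for i
    using that t(1) n by (auto simp: strict_mono_on_def)
  then obtain b where "p_rel p n u t = pc - Yv ^ t 1 * ([:u 1:] + Yv * b)"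
    unfolding p_rel_def using sum_monom_lowest[of "{1..n}" 1 t u] n by auto
  then have pw: "pc - Yv ^ t 1 * ([:u 1:] + Yv * b) \<in> I" using hI by simp
  define w where "w = [:u 1:] + Yv * b"
  have "u 1 \<notin> ideal_of [[:p:], g]" using u n by simp
  then obtain w' where w': "w * w' - 1 \<in> I"
    using unit_if_const_unit[OF I p g(1) hf g(2) nil] unfolding w_def by blast
  have pk: "pc ^ k - Yv ^ (k * t 1) * w ^ k \<in> I" for k
    using power_diff_in_class_ideal[OF I pw, of k]
    unfolding w_def[symmetric] by (simp only: power_mult_distrib power_mult[symmetric] mult.commute)
  have lower: "(r - 1) * t 1 \<le> s"
  proof (rule ccontr)
    assume "\<not> (r - 1) * t 1 \<le> s"
    then have "Yv ^ ((r - 1) * t 1) * w ^ (r - 1) \<in> I"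
      using Y_power_in_iff by (intro class_idealD(4)[OF I]) simp
    then have "(pc ^ (r - 1) - Yv ^ ((r - 1) * t 1) * w ^ (r - 1)) + Yv ^ ((r - 1) * t 1) * w ^ (r - 1) \<in> I"
      by (rule class_idealD(2)[OF I pk])
    then show False using pr1 by (simp only: diff_add_cancel simp_thms)
  qed
  have upper: "s < r * t 1"
  proof -
    have "pc ^ r - (pc ^ r - Yv ^ (r * t 1) * w ^ r) \<in> I" by (rule class_idealD(6)[OF I pr pk])
    then have "Yv ^ (r * t 1) * w ^ r \<in> I" by (simp only: diff_diff_eq2 add_diff_cancel_left')
    then have "Yv ^ (r * t 1) \<in> I" by (rule product_one_power_in_class_ideal[OF I w'])
    then show ?thesis using Y_power_in_iff by simp
  qed
  define Q where "Q = Q_ideal p r s n m g u v t e"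
  have Q: "class_ideal Q" unfolding Q_def Q_ideal_def by (rule class_ideal_ideal_of)
  \<comment> \<open>The presentation brings its own congruences for \<open>p\<close> and \<open>g\<close> modulo \<open>Y\<close>, so that elements can be
    expanded modulo \<open>Q\<close>.\<close>
  interpret cp: chain_presentation p r s n m g u v t e
    by unfold_locales (use p g n u t e lower upper in auto)
  have "Q \<subseteq> I"
  proof -
    have "t 1 \<le> s" using t(2) n by simp
    then have "t 1 + (s + 1 - t 1) = s + 1" by simp
    then have Ys: "Yv ^ t 1 * Yv ^ (s + 1 - t 1) = Yv ^ (s + 1)" by (simp only: power_add[symmetric])
    have "(pc - Yv ^ t 1 * w) * Yv ^ (s + 1 - t 1) + Yv ^ (s + 1) * w \<in> I"
      using pw nil unfolding w_def[symmetric]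
      by (intro class_idealD(2)[OF I class_idealD(4)[OF I] class_idealD(4)[OF I]])
        (simp_all only: Suc_eq_plus1)
    also have "(pc - Yv ^ t 1 * w) * Yv ^ (s + 1 - t 1) + Yv ^ (s + 1) * w = pc * Yv ^ (s + 1 - t 1)"
      unfolding Ys[symmetric] by (simp only: algebra_simps)
    finally show ?thesis unfolding Q_def Q_ideal_def
      using pr nil hI fI by (intro ideal_of_minimal[OF I]) (simp only: list.set Suc_eq_plus1 insert_subset empty_subsetI simp_thms)
  qed
  moreover have "I \<subseteq> Q"
  proof
    fix a assume a: "a \<in> I"
    obtain h'' f'' where hf': "pc - Yv * h'' \<in> Q" "[:g:] - Yv * f'' \<in> Q"
      using cp.p_mod_Y cp.g_mod_Y unfolding Q_def by blast
    have nilQ: "Yv ^ Suc s \<in> Q" using cp.Q_gens(3) unfolding Q_def by (simp only: Suc_eq_plus1)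
    obtain w where w: "\<forall>i. w i \<in> digits p (degree g)"
      and aw: "a - (\<Sum>i<Suc s. Polynomial.monom (w i) i) \<in> Q"
      using digit_expansion_nilpotent[OF Q p g(1) hf' nilQ] by blast
    then have "a - (a - (\<Sum>i<Suc s. Polynomial.monom (w i) i)) \<in> I"
      by (intro class_idealD(6)[OF I a subsetD[OF \<open>Q \<subseteq> I\<close>]])
    then have sI: "(\<Sum>i<Suc s. Polynomial.monom (w i) i) \<in> I" by (simp only: diff_diff_eq2 add_diff_cancel_left')
    have "w i = 0" if "i < Suc s" for i
      using digit_sum_unique[OF dig w sI] that by simp
    then have "(\<Sum>i<Suc s. Polynomial.monom (w i) i) = 0" by (intro sum.neutral) auto
    then show "a \<in> Q" using aw by (simp only: diff_zero)
  qed
  ultimately have "I = Q" by blast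
  show thesis
    by (rule that[of n g u m v t e]) (use n g u v t e lower upper \<open>I = Q\<close> in \<open>auto simp: Q_def\<close>)
qed

end

section \<open>Coefficients modulo \<open>p\<^sup>r\<close>\<close>

text \<open>The record view of a type-class ring, which makes the first isomorphism theorem applicable.\<close>

definition class_ring :: "'c::comm_ring_1 ring" where
  "class_ring = \<lparr>carrier = UNIV, monoid.mult = (*), one = 1, zero = 0, add = (+)\<rparr>"

lemma class_ring_simps:
  "carrier class_ring = UNIV" "\<one>\<^bsub>class_ring\<^esub> = 1" "\<zero>\<^bsub>class_ring\<^esub> = 0"
  "x \<otimes>\<^bsub>class_ring\<^esub> y = x * y" "x \<oplus>\<^bsub>class_ring\<^esub> y = x + y"
  by (simp_all add: class_ring_def)

lemma cring_class_ring: "cring (class_ring :: 'c::comm_ring_1 ring)"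
proof (rule cringI)
  have "\<exists>y. y + x = 0" for x :: 'c by (rule exI[of _ "- x"]) simp
  then show "abelian_group (class_ring :: 'c ring)"
    by (intro abelian_groupI) (simp_all add: class_ring_simps ac_simps)
  show "Group.comm_monoid (class_ring :: 'c ring)"
    by (rule comm_monoidI) (simp_all add: class_ring_simps ac_simps)
qed (simp add: class_ring_simps distrib_right)

lemma (in class_ring_hom) ring_hom_ring_class_ring:
  "ring_hom_ring class_ring R f"
proof (rule ring_hom_ringI)
  show "ring (class_ring :: 'c ring)" by (rule cring.axioms(1)[OF cring_class_ring])
qed (simp_all only: class_ring_simps hom_add hom_mult hom_one closed ring_axioms)

lemma a_kernel_class_ring: "a_kernel class_ring R f = {x. f x = \<zero>\<^bsub>R\<^esub>}"
  by (simp add: a_kernel_def kernel_def class_ring_simps)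

lemma (in class_ring_hom) FactRing_iso_class:
  assumes "range f = carrier R"
  shows "class_ring Quot {x. f x = \<zero>} \<simeq> R"
  using ring_hom_ring.FactRing_iso[OF ring_hom_ring_class_ring] assms
  unfolding a_kernel_class_ring class_ring_simps by blast

lemma (in class_ring_hom) quotient_hom:
  assumes "ideal J R"
  shows "class_ring_hom (R Quot J) (\<lambda>x. J +> f x)"
proof -
  interpret J: ideal J R by fact
  interpret Q: cring "R Quot J" by (rule J.quotient_is_cring) (rule is_cring)
  note h = J.rcos_ring_hom
  show ?thesis
    by unfold_locales
      (use ring_hom_closed[OF h] ring_hom_one[OF h] ring_hom_add[OF h] ring_hom_mult[OF h]
        in \<open>auto simp: hom_add hom_mult\<close>)
qed

lemma (in class_ring_hom) quotient_kernel:
  assumes "ideal J R"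
  shows "J +> f x = \<zero>\<^bsub>R Quot J\<^esub> \<longleftrightarrow> f x \<in> J"
proof -
  interpret J: ideal J R by fact
  show ?thesis
    using J.rcos_const_imp_mem[of "f x"] J.a_rcos_const[of "f x"] closed
    by (simp add: FactRing_def) blast
qed

lemma (in class_ring_hom) comp_ring_hom:
  assumes "cring S" "h \<in> ring_hom R S"
  shows "class_ring_hom S (\<lambda>x. h (f x))"
proof -
  interpret S: cring S by fact
  show ?thesis
    by unfold_locales
      (use ring_hom_closed[OF assms(2)] ring_hom_one[OF assms(2)] ring_hom_add[OF assms(2)]
        ring_hom_mult[OF assms(2)] in \<open>auto simp: hom_add hom_mult\<close>)
qed

text \<open>An isomorphism with a quotient of \<open>A\<close> is the same as a surjection with prescribed kernel.  Since \<open>A\<close> is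
itself the image of a type-class ring under \<open>\<rho>\<close>, the surjection may start from that ring.\<close>

lemma iso_quotient_iff:
  assumes R: "cring R" and \<rho>: "class_ring_hom A \<rho>" "range \<rho> = carrier A" and J: "ideal J A"
  shows "R \<simeq> A Quot J \<longleftrightarrow>
    (\<exists>\<Phi>. class_ring_hom R \<Phi> \<and> range \<Phi> = carrier R \<and> (\<forall>x. \<Phi> x = \<zero>\<^bsub>R\<^esub> \<longleftrightarrow> \<rho> x \<in> J))"
    (is "_ \<longleftrightarrow> ?R")
proof -
  interpret R: cring R by fact
  interpret \<rho>: class_ring_hom A \<rho> by fact
  interpret J: ideal J A by fact
  interpret Q: class_ring_hom "A Quot J" "\<lambda>x. J +>\<^bsub>A\<^esub> \<rho> x" by (rule \<rho>.quotient_hom[OF J])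
  have "carrier (A Quot J) = (\<lambda>a. J +>\<^bsub>A\<^esub> a) ` range \<rho>"
    unfolding \<rho>(2) by (auto simp: FactRing_def A_RCOSETS_def')
  then have rQ: "range (\<lambda>x. J +>\<^bsub>A\<^esub> \<rho> x) = carrier (A Quot J)" by (simp add: image_image)
  show ?thesis
  proof
    assume "R \<simeq> A Quot J"
    then have "A Quot J \<simeq> R" using ring_iso_sym[OF R.ring_axioms] by blast
    then obtain h where h: "h \<in> ring_iso (A Quot J) R" unfolding is_ring_iso_def by blast
    then have hom: "h \<in> ring_hom (A Quot J) R" and bij: "bij_betw h (carrier (A Quot J)) (carrier R)"
      unfolding ring_iso_def by auto
    let ?\<Phi> = "\<lambda>x. h (J +>\<^bsub>A\<^esub> \<rho> x)"
    interpret P: class_ring_hom R ?\<Phi> by (rule Q.comp_ring_hom[OF R hom])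
    have "range ?\<Phi> = h ` range (\<lambda>x. J +>\<^bsub>A\<^esub> \<rho> x)" by (simp add: image_image)
    then have 1: "range ?\<Phi> = carrier R" using rQ bij by (simp add: bij_betw_def)
    have 2: "?\<Phi> x = \<zero>\<^bsub>R\<^esub> \<longleftrightarrow> \<rho> x \<in> J" for x
    proof -
      have "?\<Phi> x = \<zero>\<^bsub>R\<^esub> \<longleftrightarrow> ?\<Phi> x = ?\<Phi> 0" by (simp only: P.hom_zero)
      also have "\<dots> \<longleftrightarrow> J +>\<^bsub>A\<^esub> \<rho> x = J +>\<^bsub>A\<^esub> \<rho> 0"
        by (rule inj_on_eq_iff[OF bij_betw_imp_inj_on[OF bij] Q.closed Q.closed])
      also have "\<dots> \<longleftrightarrow> \<rho> x \<in> J" using \<rho>.quotient_kernel[OF J] Q.hom_zero by simp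
      finally show ?thesis .
    qed
    show ?R
      by (rule exI[of _ ?\<Phi>], rule conjI[OF P.class_ring_hom_axioms], rule conjI[OF 1], rule allI, rule 2)
  next
    assume ?R
    then obtain \<Phi> where \<Phi>: "class_ring_hom R \<Phi>" "range \<Phi> = carrier R"
      and ker: "\<forall>x. \<Phi> x = \<zero>\<^bsub>R\<^esub> \<longleftrightarrow> \<rho> x \<in> J" by (elim exE conjE)
    interpret P: class_ring_hom R \<Phi> by fact
    have eq: "{x. \<Phi> x = \<zero>\<^bsub>R\<^esub>} = {x. J +>\<^bsub>A\<^esub> \<rho> x = \<zero>\<^bsub>A Quot J\<^esub>}"
      using ker \<rho>.quotient_kernel[OF J] by simp
    have 1: "class_ring Quot {x. \<Phi> x = \<zero>\<^bsub>R\<^esub>} \<simeq> R"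
      by (rule P.FactRing_iso_class[OF \<Phi>(2)])
    have 2: "class_ring Quot {x. J +>\<^bsub>A\<^esub> \<rho> x = \<zero>\<^bsub>A Quot J\<^esub>} \<simeq> A Quot J"
      by (rule Q.FactRing_iso_class[OF rQ])
    have 3: "ring (class_ring Quot {x. \<Phi> x = \<zero>\<^bsub>R\<^esub>})"
      using ideal.quotient_is_ring[OF ring_hom_ring.kernel_is_ideal[OF P.ring_hom_ring_class_ring]]
      unfolding a_kernel_class_ring .
    show "R \<simeq> A Quot J" by (rule ring_iso_trans[OF ring_iso_sym[OF 3 1] 2[folded eq]])
  qed
qed

lemma (in class_ring_hom) Units_iff:
  assumes "range f = carrier R"
  shows "f a \<in> Units R \<longleftrightarrow> (\<exists>b. f (a * b - 1) = \<zero>)"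
proof
  assume "f a \<in> Units R"
  then obtain c where "c \<in> carrier R" "f a \<otimes> c = \<one>" unfolding Units_def by blast
  then obtain b where "f a \<otimes> f b = \<one>" using assms by (metis imageE)
  then have "f (a * b - 1) = \<zero>" by (simp add: diff_kernel_iff hom_mult)
  then show "\<exists>b. f (a * b - 1) = \<zero>" by blast
next
  assume "\<exists>b. f (a * b - 1) = \<zero>"
  then obtain b where "f a \<otimes> f b = \<one>" by (auto simp: diff_kernel_iff hom_mult)
  moreover from this have "f b \<otimes> f a = \<one>" using m_comm[of "f b" "f a"] by simp
  ultimately show "f a \<in> Units R" unfolding Units_def using closed by blast
qed

lemma residue_ring_simps:
  "\<zero>\<^bsub>residue_ring m\<^esub> = 0" "\<one>\<^bsub>residue_ring m\<^esub> = 1" "carrier (residue_ring m) = {0..m - 1}"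
  by (simp_all add: residue_ring_def)

text \<open>Reduction of coefficients modulo \<open>k\<close>.  Coefficient functions of \<open>ZX k\<close> take least nonnegative
residues as values, which is exactly what \<open>mod\<close> returns.\<close>

definition redX :: "nat \<Rightarrow> int poly \<Rightarrow> nat \<Rightarrow> int" where
  "redX k P = (\<lambda>i. poly.coeff P i mod int k)"

definition redXY :: "nat \<Rightarrow> int poly poly \<Rightarrow> nat \<Rightarrow> nat \<Rightarrow> int" where
  "redXY k P = (\<lambda>i. redX k (poly.coeff P i))"

context
  fixes k :: nat
  assumes k: "k > 1"
begin

interpretation Z: class_ring_hom "residue_ring (int k)" "\<lambda>n. n mod int k"
  using k by (intro class_ring_hom_residue_ring) simp

lemma map_up_redX: "Z.map_up = redX k"
  by (simp add: fun_eq_iff Z.map_up_def redX_def)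

lemma redX_hom: "class_ring_hom (ZX k) (redX k)"
  using Z.map_up_hom unfolding map_up_redX .

lemma range_redX: "range (redX k) = carrier (ZX k)"
  using Z.map_up_surj[OF range_mod_residue_ring] k unfolding map_up_redX by simp

lemma redX_eq_zero_iff: "redX k P = \<zero>\<^bsub>ZX k\<^esub> \<longleftrightarrow> [:int k:] dvd P"
  using Z.map_up_eq_zero[of P] unfolding map_up_redX
  by (simp add: const_poly_dvd_iff residue_ring_def mod_eq_0_iff_dvd)

interpretation X: class_ring_hom "ZX k" "redX k" by (rule redX_hom)

lemma map_up_redXY: "X.map_up = redXY k"
  by (simp add: fun_eq_iff X.map_up_def redXY_def)

lemma redXY_hom: "class_ring_hom (ZXY k) (redXY k)"
  using X.map_up_hom unfolding map_up_redXY .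

lemma range_redXY: "range (redXY k) = carrier (ZXY k)"
  using X.map_up_surj[OF range_redX] unfolding map_up_redXY .

lemma redXY_eq_zero_iff: "redXY k P = \<zero>\<^bsub>ZXY k\<^esub> \<longleftrightarrow> [:[:int k:]:] dvd P"
  using X.map_up_eq_zero[of P] redX_eq_zero_iff unfolding map_up_redXY
  by (simp add: const_poly_dvd_iff)

lemma redXY_monom: "redXY k (Polynomial.monom a n) = up_ring.monom (ZXY k) (redX k a) n"
  using X.map_up_monom[of a n] unfolding map_up_redXY .

lemma degX_redX_le: "degX k (redX k P) \<le> degree P"
proof -
  interpret U: UP_cring "residue_ring (int k)" "ZX k"
    using Z.is_cring by (simp add: UP_cring_def)
  have "redX k P \<in> carrier (ZX k)" using X.closed .
  then show ?thesis
    by (intro U.deg_aboveI) (auto simp: UP_def redX_def coeff_eq_0 residue_ring_def)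
qed

lemma monic_redX:
  assumes "lead_coeff P = 1"
  shows "degX k (redX k P) = degree P" "monicX k (redX k P)"
proof -
  interpret U: UP_cring "residue_ring (int k)" "ZX k"
    using Z.is_cring by (simp add: UP_cring_def)
  have c: "redX k P \<in> carrier (ZX k)" using X.closed .
  have co: "up_ring.coeff (ZX k) (redX k P) i = redX k P i" for i
    using c by (simp add: UP_def)
  have 1: "redX k P (degree P) = \<one>\<^bsub>residue_ring (int k)\<^esub>"
    using assms k by (simp add: redX_def residue_ring_def)
  have "degree P \<le> degX k (redX k P)"
    by (rule U.deg_belowI) (use 1 c in \<open>simp_all add: co residue_ring_simps\<close>)
  then show "degX k (redX k P) = degree P" using degX_redX_le by (metis le_antisym)
  then show "monicX k (redX k P)" unfolding monicX_def co using 1 by simp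
qed

lemma monic_lift:
  assumes "g \<in> carrier (ZX k)" "monicX k g"
  obtains P where "lead_coeff P = 1" "redX k P = g"
proof -
  interpret U: UP_cring "residue_ring (int k)" "ZX k"
    using Z.is_cring by (simp add: UP_cring_def)
  have co: "up_ring.coeff (ZX k) g i = g i" for i using assms(1) by (simp add: UP_def)
  have car: "g i \<in> {0..<int k}" for i
    using U.coeff_closed[OF assms(1), of i] by (simp add: co residue_ring_simps)
  let ?d = "degX k g"
  have zero: "g i = 0" if "?d < i" for i
    using U.deg_aboveD[OF that assms(1)] by (simp add: co residue_ring_simps)
  define P where "P = Poly (map g [0..<Suc ?d])"
  have P: "poly.coeff P i = g i" for i
    using zero[of i] by (auto simp: P_def nth_default_def simp del: upt_Suc)
  have g1: "g ?d = 1" using assms(2) unfolding monicX_def co by (simp add: residue_ring_simps)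
  have "degree P = ?d"
    by (rule antisym) (use g1 in \<open>auto intro!: degree_le le_degree simp: P zero\<close>)
  then have "lead_coeff P = 1" using g1 by (simp add: P)
  moreover have "redX k P = g" using car by (auto simp: redX_def P fun_eq_iff)
  ultimately show thesis using that by blast
qed

end

lemma reduce_mod_redX: "p dvd k \<Longrightarrow> reduce_mod p (redX k P) = redX p P"
  by (simp add: reduce_mod_def redX_def fun_eq_iff mod_mod_cancel)

lemma ring_irreducible_redX_iff:
  assumes p: "prime (p::nat)"
  shows "ring_irreducible\<^bsub>ZX p\<^esub> (redX p g) \<longleftrightarrow> irreducible_mod (int p) g"
proof -
  have p1: "p > 1" using p prime_gt_1_nat by blast
  interpret residues_prime p "residue_ring (int p)" using p by unfold_locales auto
  interpret F: field "residue_ring (int p)" by (rule is_field)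
  interpret U: UP_domain "residue_ring (int p)" "ZX p" by unfold_locales simp
  interpret X: class_ring_hom "ZX p" "redX p" by (rule redX_hom[OF p1])
  note range = range_redX[OF p1] and ker = redX_eq_zero_iff[OF p1]
  have unit: "redX p a \<in> Units (ZX p) \<longleftrightarrow> unit_mod (int p) a" for a
    unfolding X.Units_iff[OF range] ker unit_mod_def ..
  have prod: "redX p g = redX p a \<otimes>\<^bsub>ZX p\<^esub> redX p b \<longleftrightarrow> [:int p:] dvd g - a * b" for a b
    unfolding X.hom_mult[symmetric] X.diff_kernel_iff[symmetric] ker ..
  show ?thesis
  proof
    assume irr: "ring_irreducible\<^bsub>ZX p\<^esub> (redX p g)"
    note E = domain.ring_irreducibleE[OF U.UP_domain X.closed irr]
    show "irreducible_mod (int p) g" unfolding irreducible_mod_def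
      using E(1,4) E(5)[OF X.closed X.closed] unfolding unit prod ker by blast
  next
    assume irr: "irreducible_mod (int p) g"
    show "ring_irreducible\<^bsub>ZX p\<^esub> (redX p g)"
    proof (rule domain.ring_irreducibleI[OF U.UP_domain])
      show "redX p g \<in> carrier (ZX p) - {\<zero>\<^bsub>ZX p\<^esub>}" "redX p g \<notin> Units (ZX p)"
        using irr X.closed unfolding irreducible_mod_def unit ker[symmetric] by auto
      fix a b assume "a \<in> carrier (ZX p)" "b \<in> carrier (ZX p)" and ab: "redX p g = a \<otimes>\<^bsub>ZX p\<^esub> b"
      then obtain a' b' where "a = redX p a'" "b = redX p b'" using range by (metis imageE)
      then show "a \<in> Units (ZX p) \<or> b \<in> Units (ZX p)"
        using ab irr unfolding irreducible_mod_def by (simp only: unit prod)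
    qed
  qed
qed

lemma (in ring) Idl_insert_zero: "S \<subseteq> carrier R \<Longrightarrow> Idl (insert \<zero> S) = Idl S"
proof (rule antisym)
  assume S: "S \<subseteq> carrier R"
  interpret I: ideal "Idl S" R by (rule genideal_ideal[OF S])
  show "Idl (insert \<zero> S) \<subseteq> Idl S"
    using genideal_self[OF S] by (intro genideal_minimal genideal_ideal S) auto
  show "Idl S \<subseteq> Idl (insert \<zero> S)" using S by (intro subset_Idl_subset) (auto intro: genideal_self)
qed

text \<open>The kernel of reduction modulo \<open>p\<^sup>r\<close> is generated by \<open>p\<^sup>r\<close>, a multiple of \<open>p\<close>.\<close>

lemma redX_in_ideal_pg_iff:
  assumes p: "prime (p::nat)" and r: "r \<ge> 1"
  shows "redX (p ^ r) a \<in> ideal_pg p r (redX (p ^ r) g) \<longleftrightarrow> a \<in> ideal_of [[:int p:], g]"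
proof -
  have k: "p ^ r > 1" using one_less_power[OF prime_gt_1_nat[OF p], of r] r by simp
  interpret X: class_ring_hom "ZX (p ^ r)" "redX (p ^ r)" by (rule redX_hom[OF k])
  let ?I = "ideal_of [[:int p:], g]"
  note I = class_ideal_ideal_of[of "[[:int p:], g]"]
  have "[:int p:] \<in> ?I" using generators_in_ideal_of[of "[[:int p:], g]"] unfolding list.set by blast
  moreover have "[:int p:] dvd [:int (p ^ r):]" using r by (auto simp: const_poly_dvd_iff coeff_pCons split: nat.split)
  ultimately have "x \<in> ?I" if "redX (p ^ r) x = \<zero>\<^bsub>ZX (p ^ r)\<^esub>" for x
    using that dvd_in_class_ideal[OF I] unfolding redX_eq_zero_iff[OF k] by (meson dvd_trans)
  then have "redX (p ^ r) a \<in> Idl\<^bsub>ZX (p ^ r)\<^esub> (redX (p ^ r) ` set [[:int p:], g]) \<longleftrightarrow> a \<in> ?I"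
    by (rule X.Idl_image[OF range_redX[OF k]])
  moreover have "redX (p ^ r) [:int p:] = [p] \<cdot>\<^bsub>ZX (p ^ r)\<^esub> \<one>\<^bsub>ZX (p ^ r)\<^esub>"
    using X.hom_of_nat[of p] by (simp add: of_nat_poly)
  ultimately show ?thesis unfolding ideal_pg_def by simp
qed

text \<open>The kernel of reduction modulo \<open>p\<^sup>r\<close> is absorbed by the generator \<open>p\<^sup>r\<close> of \<open>Q_ideal\<close>, whose image
is zero and can be dropped from the generators of the image.\<close>

lemma redXY_in_ideal_Q_iff:
  assumes p: "prime (p::nat)" and r: "r \<ge> 1"
  defines "q \<equiv> redX (p ^ r)"
  shows "redXY (p ^ r) a \<in> ideal_Q p r s n m (q g) (\<lambda>i. q (u i)) (\<lambda>j. q (v j)) t e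
    \<longleftrightarrow> a \<in> Q_ideal (int p) r s n m g u v t e"
    and "ideal (ideal_Q p r s n m (q g) (\<lambda>i. q (u i)) (\<lambda>j. q (v j)) t e) (ZXY (p ^ r))"
proof -
  have k: "p ^ r > 1" using one_less_power[OF prime_gt_1_nat[OF p], of r] r by simp
  interpret X: class_ring_hom "ZX (p ^ r)" "redX (p ^ r)" by (rule redX_hom[OF k])
  interpret XY: class_ring_hom "ZXY (p ^ r)" "redXY (p ^ r)" by (rule redXY_hom[OF k])
  note mon = redXY_monom[OF k]
  let ?f = "redXY (p ^ r)" and ?S = "ZXY (p ^ r)"
  let ?L = "[[:[:int p:]:] * Yv ^ (s + 1 - t 1), Yv ^ (s + 1), p_rel (int p) n u t, g_rel g m v e]"
  have of_nat_p: "[:[:int p:]:] = of_nat p" by (simp add: of_nat_poly)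
  have Yp: "Yv ^ i = Polynomial.monom 1 i" for i by (simp add: monom_altdef)
  have 0: "?f ([:[:int p:]:] ^ r) = \<zero>\<^bsub>?S\<^esub>"
    unfolding redXY_eq_zero_iff[OF k] by (simp add: poly_const_pow)
  have 1: "?f ([:[:int p:]:] * Yv ^ i) = [p] \<cdot>\<^bsub>?S\<^esub> up_ring.monom ?S \<one>\<^bsub>ZX (p ^ r)\<^esub> i" for i
    unfolding of_nat_p XY.hom_of_nat_mult Yp mon by simp
  have 2: "?f (Yv ^ i) = up_ring.monom ?S \<one>\<^bsub>ZX (p ^ r)\<^esub> i" for i
    unfolding Yp mon by simp
  have 3: "?f (p_rel (int p) n u t) = [p] \<cdot>\<^bsub>?S\<^esub> \<one>\<^bsub>?S\<^esub> \<ominus>\<^bsub>?S\<^esub>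
      (\<Oplus>\<^bsub>?S\<^esub>i\<in>{1..n}. up_ring.monom ?S (q (u i)) (t i))"
    unfolding p_rel_def of_nat_p XY.hom_diff XY.hom_of_nat XY.hom_sum[OF finite_atLeastAtMost] mon q_def ..
  have 4: "?f (g_rel g m v e) = up_ring.monom ?S (q g) 0 \<ominus>\<^bsub>?S\<^esub>
      (\<Oplus>\<^bsub>?S\<^esub>j\<in>{1..m}. up_ring.monom ?S (q (v j)) (e j))"
    unfolding g_rel_def XY.hom_diff XY.hom_sum[OF finite_atLeastAtMost] mon monom_0[symmetric] q_def ..
  have Q: "ideal_Q p r s n m (q g) (\<lambda>i. q (u i)) (\<lambda>j. q (v j)) t e = Idl\<^bsub>?S\<^esub> (?f ` set ?L)"
    unfolding ideal_Q_def Let_def list.set image_insert image_empty 1 2 3 4 ..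
  show "ideal (ideal_Q p r s n m (q g) (\<lambda>i. q (u i)) (\<lambda>j. q (v j)) t e) ?S"
    unfolding Q by (rule XY.genideal_ideal, rule image_subsetI, rule XY.closed)
  have "Idl\<^bsub>?S\<^esub> (?f ` set ?L) = Idl\<^bsub>?S\<^esub> (insert \<zero>\<^bsub>?S\<^esub> (?f ` set ?L))"
    by (rule XY.Idl_insert_zero[symmetric], rule image_subsetI, rule XY.closed)
  also have "insert \<zero>\<^bsub>?S\<^esub> (?f ` set ?L) = ?f ` set ([:[:int p:]:] ^ r # ?L)"
    unfolding list.set(2)[of "[:[:int p:]:] ^ r"] image_insert[of _ "[:[:int p:]:] ^ r"] 0 ..
  finally have Q': "ideal_Q p r s n m (q g) (\<lambda>i. q (u i)) (\<lambda>j. q (v j)) t e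
    = Idl\<^bsub>?S\<^esub> (?f ` set ([:[:int p:]:] ^ r # ?L))" unfolding Q .
  let ?I = "ideal_of ([:[:int p:]:] ^ r # ?L)"
  have "[:[:int p:]:] ^ r \<in> ?I" using generators_in_ideal_of[of "[:[:int p:]:] ^ r # ?L"] by auto
  then have "[:[:int (p ^ r):]:] \<in> ?I" by (simp add: poly_const_pow)
  then have "x \<in> ?I" if "?f x = \<zero>\<^bsub>?S\<^esub>" for x
    using that unfolding redXY_eq_zero_iff[OF k] by (rule dvd_in_class_ideal[OF class_ideal_ideal_of])
  then have "?f a \<in> Idl\<^bsub>?S\<^esub> (?f ` set ([:[:int p:]:] ^ r # ?L)) \<longleftrightarrow> a \<in> ?I"
    by (rule XY.Idl_image[OF range_redXY[OF k]])
  then show "?f a \<in> ideal_Q p r s n m (q g) (\<lambda>i. q (u i)) (\<lambda>j. q (v j)) t e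
    \<longleftrightarrow> a \<in> Q_ideal (int p) r s n m g u v t e"
    unfolding Q' Q_ideal_def .
qed

section \<open>Generators of a finite chain ring\<close>

context cring
begin

text \<open>The multiplicative group of the finite residue field is cyclic; \<open>x\<close> lifts a generator.\<close>

lemma residue_field_generator:
  assumes fin: "finite (carrier R)" and y: "chain_gen R s y"
  shows "\<exists>x\<in>carrier R. \<forall>a\<in>carrier R. \<exists>b\<in>carrier R. a = y \<otimes> b \<or> (\<exists>i::nat. a = x [^] i \<oplus> y \<otimes> b)"
proof -
  note D = chain_genD[OF y]
  let ?M = "PIdl y"
  have carF: "carrier (R Quot ?M) = (+>) ?M ` carrier R"
    by (auto simp: FactRing_def A_RCOSETS_def')
  have M: "\<exists>b\<in>carrier R. a = y \<otimes> b" if "a \<in> ?M" for a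
    using that m_comm D(1) unfolding cgenideal_def by blast
  have zeroF: "\<zero>\<^bsub>R Quot ?M\<^esub> = ?M" by (simp add: FactRing_def)
  interpret M: maximalideal ?M R by (rule chain_gen_maximalideal[OF y])
  interpret F: field "R Quot ?M" by (rule M.quotient_is_field) (rule is_cring)
  interpret h: ring_hom_ring R "R Quot ?M" "(+>) ?M" by (rule M.rcos_ring_hom_ring)
  have finF: "finite (carrier (R Quot ?M))" unfolding carF by (rule finite_imageI[OF fin])
  let ?G = "Multiplicative_Group.mult_of (R Quot ?M)"
  have "\<exists>z\<in>carrier ?G. carrier ?G = {z [^]\<^bsub>R Quot ?M\<^esub> i | i::nat. i \<in> UNIV}"
    by (rule F.finite_field_mult_group_has_gen[OF finF])
  then obtain z where z: "z \<in> carrier ?G" and gen: "carrier ?G = {z [^]\<^bsub>R Quot ?M\<^esub> i | i::nat. i \<in> UNIV}"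
    by (rule bexE)
  have "z \<in> (+>) ?M ` carrier R" using z unfolding Multiplicative_Group.carrier_mult_of carF by (rule DiffD1)
  then obtain x where x: "x \<in> carrier R" "z = ?M +> x" by blast
  have "\<exists>b\<in>carrier R. a = y \<otimes> b \<or> (\<exists>i::nat. a = x [^] i \<oplus> y \<otimes> b)" if a: "a \<in> carrier R" for a
  proof (cases "a \<in> ?M")
    case True
    then show ?thesis using M by blast
  next
    case False
    have "?M +> a \<noteq> \<zero>\<^bsub>R Quot ?M\<^esub>"
      using False M.rcos_const_imp_mem[OF a] unfolding zeroF by blast
    moreover have "?M +> a \<in> carrier (R Quot ?M)" unfolding carF using a by (rule imageI)
    ultimately have "?M +> a \<in> carrier ?G" unfolding Multiplicative_Group.carrier_mult_of by simp
    then obtain i :: nat where "?M +> a = z [^]\<^bsub>R Quot ?M\<^esub> i" unfolding gen by (elim CollectE exE conjE)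
    then have "?M +> a = ?M +> (x [^] i)" unfolding x(2) h.hom_nat_pow[OF x(1)] .
    then have "a \<ominus> x [^] i \<in> ?M"
      using quotient_eq_iff_same_a_r_cos[OF M.is_ideal a nat_pow_closed[OF x(1)]] by blast
    then obtain b where b: "b \<in> carrier R" "a \<ominus> x [^] i = y \<otimes> b" using M by blast
    have "a = x [^] i \<oplus> (a \<ominus> x [^] i)" using a x(1) by (simp add: a_minus_def a_lcomm r_neg)
    then show ?thesis using b by auto
  qed
  then show ?thesis using x(1) by blast
qed

text \<open>Splitting off a power of \<open>x\<close> and continuing with the multiple of \<open>y\<close> that is left, each element
becomes a polynomial in \<open>x\<close> and \<open>y\<close> after \<open>s + 1\<close> steps.\<close>

lemma presenting_hom:
  assumes fin: "finite (carrier R)" and y: "chain_gen R s y"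
  obtains \<Phi> :: "int poly poly \<Rightarrow> 'a" where "class_ring_hom R \<Phi>" "range \<Phi> = carrier R" "\<Phi> Yv = y"
    "\<exists>f. lead_coeff f = 1 \<and> \<Phi> [:f:] = \<zero>"
proof -
  note D = chain_genD[OF y]
  obtain x where x: "x \<in> carrier R"
    and gen: "\<And>a. a \<in> carrier R \<Longrightarrow> \<exists>b\<in>carrier R. a = y \<otimes> b \<or> (\<exists>i::nat. a = x [^] i \<oplus> y \<otimes> b)"
    using residue_field_generator[OF fin y] by blast
  interpret Z: class_ring_hom R "\<lambda>n::int. [n] \<cdot> \<one>" by (rule class_ring_hom_of_int)
  interpret X: class_ring_hom R "Z.peval x" by (rule Z.peval_hom[OF x])
  interpret P: class_ring_hom R "X.peval y" by (rule X.peval_hom[OF D(1)])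
  let ?P = "X.peval y"
  have Py: "?P Yv = y" using D(1) by (simp add: X.peval_pCons)
  have Px: "Z.peval x [:0, 1:] = x" using x by (simp add: Z.peval_pCons)
  have Pc: "?P [:a:] = Z.peval x a" for a by (rule X.peval_const[OF D(1)])
  have Pxi: "?P [:[:0, 1:] ^ i:] = x [^] i" for i by (simp add: Pc X.hom_power Px)
  have approx: "\<exists>Q. \<exists>b\<in>carrier R. a = ?P Q \<oplus> y [^] k \<otimes> b" if a: "a \<in> carrier R" for a and k :: nat
  proof (induction k)
    case 0
    show ?case using a by (intro exI[of _ 0] bexI[of _ a]) simp_all
  next
    case (Suc k)
    then obtain Q b where Q: "b \<in> carrier R" "a = ?P Q \<oplus> y [^] k \<otimes> b" by blast
    obtain c where c: "c \<in> carrier R" "b = y \<otimes> c \<or> (\<exists>i::nat. b = x [^] i \<oplus> y \<otimes> c)" using gen[OF Q(1)] by blast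
    then obtain Q' where Q': "b = ?P Q' \<oplus> y \<otimes> c"
    proof (elim disjE exE)
      assume "b = y \<otimes> c"
      then have "b = ?P 0 \<oplus> y \<otimes> c" using c(1) D(1) by simp
      then show thesis by (rule that)
    next
      fix i :: nat assume "b = x [^] i \<oplus> y \<otimes> c"
      then have "b = ?P [:[:0, 1:] ^ i:] \<oplus> y \<otimes> c" unfolding Pxi .
      then show thesis by (rule that)
    qed
    have "a = ?P (Q + Yv ^ k * Q') \<oplus> y [^] Suc k \<otimes> c"
      unfolding Q(2) Q' P.hom_add P.hom_mult P.hom_power Py
      using c(1) D(1) by (simp add: r_distr a_assoc m_assoc)
    then show ?case using c(1) by blast
  qed
  have range: "range ?P = carrier R"
  proof
    show "carrier R \<subseteq> range ?P"
    proof
      fix a assume "a \<in> carrier R"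
      then obtain Q b where "b \<in> carrier R" "a = ?P Q \<oplus> y [^] Suc s \<otimes> b" using approx[of a "Suc s"] by blast
      then have "a = ?P Q" unfolding D(2) by simp
      then show "a \<in> range ?P" by blast
    qed
  qed auto
  have "\<not> inj (\<lambda>n::nat. x [^] n)"
    using x fin by (metis finite_imageD finite_subset image_subsetI infinite_UNIV_nat nat_pow_closed)
  then obtain i j :: nat where ij: "i < j" "x [^] i = x [^] j" by (meson linorder_injI)
  define f :: "int poly" where "f = [:0, 1:] ^ j - [:0, 1:] ^ i"
  have f: "f = Polynomial.monom 1 j - Polynomial.monom 1 i" by (simp add: f_def monom_altdef)
  have "degree f = j"
  proof (rule antisym)
    show "degree f \<le> j" unfolding f using ij(1) by (intro degree_diff_le degree_monom_le[THEN order_trans]) auto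
    show "j \<le> degree f" by (rule le_degree) (use ij(1) in \<open>simp add: f\<close>)
  qed
  then have "lead_coeff f = 1" using ij(1) by (simp add: f)
  moreover have "?P [:f:] = \<zero>"
    unfolding Pc f_def X.diff_kernel_iff X.hom_power Px using ij(2) by simp
  ultimately show thesis using that[OF P.class_ring_hom_axioms range Py] by blast
qed

end

section \<open>The characterization\<close>

lemma hom_const_power:
  fixes f :: "int poly poly \<Rightarrow> 'a"
  assumes "class_ring_hom R f"
  shows "f ([:[:int p:]:] ^ k) = [(p ^ k)] \<cdot>\<^bsub>R\<^esub> \<one>\<^bsub>R\<^esub>"
proof -
  have "[:[:int p:]:] ^ k = of_nat (p ^ k)" by (simp add: of_nat_poly poly_const_pow)
  then show ?thesis by (simp only: class_ring_hom.hom_of_nat[OF assms])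
qed

text \<open>The polynomials are lifted to integer coefficients, \<open>g\<close> to a monic one.  The isomorphism then becomes a
surjection from \<open>\<int>[X][Y]\<close> with kernel \<open>Q_ideal\<close>, and the properties of this ideal turn into
properties of \<open>R\<close>.\<close>

lemma presentation_imp_chain_ring:
  fixes R :: "('a, 'b) ring_scheme" and p r s n m :: nat
  assumes "cring R" and p: "prime p" and r: "r \<ge> 2" and n: "n \<ge> 1"
    and g: "g \<in> carrier (ZX (p ^ r))" "monicX (p ^ r) g" "ring_irreducible\<^bsub>ZX p\<^esub> (reduce_mod p g)"
    and u: "\<forall>i\<in>{1..n}. u i \<in> carrier (ZX (p ^ r)) - ideal_pg p r g"
    and v: "\<forall>j\<in>{1..m}. v j \<in> carrier (ZX (p ^ r))"
    and t: "\<forall>i\<in>{1..n}. 1 \<le> t i \<and> t i \<le> s" "strict_mono_on {1..n} t"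
    and e: "\<forall>j\<in>{1..m}. 1 \<le> e j"
    and bounds: "(r - 1) * t 1 \<le> s" "s < r * t 1"
    and iso: "R \<simeq> ZXY (p ^ r) Quot ideal_Q p r s n m g u v t e"
  shows "finite (carrier R)" "\<exists>y. chain_gen R s y" "ring_char R = p ^ r"
proof -
  interpret R: cring R by fact
  have r1: "r \<ge> 1" "p dvd p ^ r" using r by (auto intro: dvd_power)
  have k: "p ^ r > 1" using one_less_power[OF prime_gt_1_nat[OF p], of r] r by simp
  let ?q = "redX (p ^ r)"
  obtain G where G: "lead_coeff G = 1" "?q G = g" using monic_lift[OF k g(1,2)] by blast
  define U where "U = (\<lambda>i. inv_into UNIV ?q (u i))"
  define V where "V = (\<lambda>j. inv_into UNIV ?q (v j))"
  have U: "?q (U i) = u i" if "i \<in> {1..n}" for i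
    unfolding U_def using u that range_redX[OF k] by (intro f_inv_into_f) blast
  have V: "?q (V j) = v j" if "j \<in> {1..m}" for j
    unfolding V_def using v that range_redX[OF k] by (intro f_inv_into_f) blast
  interpret XY: cring "ZXY (p ^ r)"
    using redXY_hom[OF k] by (rule class_ring_hom.axioms(1))
  have "ideal_Q p r s n m g u v t e = ideal_Q p r s n m (?q G) (\<lambda>i. ?q (U i)) (\<lambda>j. ?q (V j)) t e"
  proof -
    have "(\<Oplus>\<^bsub>ZXY (p ^ r)\<^esub>i\<in>{1..n}. up_ring.monom (ZXY (p ^ r)) (u i) (t i))
        = (\<Oplus>\<^bsub>ZXY (p ^ r)\<^esub>i\<in>{1..n}. up_ring.monom (ZXY (p ^ r)) (?q (U i)) (t i))"
      using U redXY_monom[OF k, symmetric] class_ring_hom.closed[OF redXY_hom[OF k]]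
      by (intro XY.finsum_cong') auto
    moreover have "(\<Oplus>\<^bsub>ZXY (p ^ r)\<^esub>j\<in>{1..m}. up_ring.monom (ZXY (p ^ r)) (v j) (e j))
        = (\<Oplus>\<^bsub>ZXY (p ^ r)\<^esub>j\<in>{1..m}. up_ring.monom (ZXY (p ^ r)) (?q (V j)) (e j))"
      using V redXY_monom[OF k, symmetric] class_ring_hom.closed[OF redXY_hom[OF k]]
      by (intro XY.finsum_cong') auto
    ultimately show ?thesis unfolding ideal_Q_def Let_def G(2) by simp
  qed
  note iso' = iso[unfolded this]
  note Q = redXY_in_ideal_Q_iff[OF p r1(1)]
  obtain \<Phi> where \<Phi>: "class_ring_hom R \<Phi>" "range \<Phi> = carrier R"
    and ker: "\<forall>x. \<Phi> x = \<zero>\<^bsub>R\<^esub> \<longleftrightarrow> x \<in> Q_ideal (int p) r s n m G U V t e"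
    using iso' unfolding iso_quotient_iff[OF \<open>cring R\<close> redXY_hom[OF k] range_redXY[OF k] Q(2)] Q(1)
    by (elim exE conjE)
  interpret P: class_ring_hom R \<Phi> by (rule \<Phi>(1))
  have irr: "irreducible_mod (int p) G"
    using g(3) reduce_mod_redX[OF r1(2), of G] ring_irreducible_redX_iff[OF p] G(2) by simp
  have u1: "U 1 \<notin> ideal_of [[:int p:], G]"
    using u U[of 1] n redX_in_ideal_pg_iff[OF p r1(1), of "U 1" G] G(2) by auto
  interpret CP: chain_presentation "int p" r s n m G U V t e
    by unfold_locales (use p G(1) irr n u1 t e bounds in auto)
  note I = ker[rule_format, symmetric]
  obtain F where F: "finite F" "\<forall>a. \<exists>b\<in>F. a - b \<in> CP.Q" using CP.Q_finite_representatives by blast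
  have "carrier R \<subseteq> \<Phi> ` F"
  proof
    fix c assume "c \<in> carrier R"
    then obtain a where "c = \<Phi> a" using \<Phi>(2) by blast
    moreover obtain b where "b \<in> F" "a - b \<in> CP.Q" using F(2) by blast
    ultimately show "c \<in> \<Phi> ` F" unfolding I P.diff_kernel_iff by blast
  qed
  then show "finite (carrier R)" using F(1) finite_surj by blast
  have "chain_gen R s (\<Phi> Yv)" unfolding chain_gen_def
  proof (intro conjI ballI)
    show "\<Phi> Yv [^]\<^bsub>R\<^esub> Suc s = \<zero>\<^bsub>R\<^esub>" "\<Phi> Yv [^]\<^bsub>R\<^esub> s \<noteq> \<zero>\<^bsub>R\<^esub>"
      unfolding P.hom_power[symmetric] I[symmetric] using CP.Q_gens(3) CP.Y_power_notin by (simp_all only: Suc_eq_plus1 simp_thms)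
    fix c assume "c \<in> carrier R"
    then obtain a where a: "c = \<Phi> a" using \<Phi>(2) by blast
    show "c \<in> Units R \<or> (\<exists>b\<in>carrier R. c = \<Phi> Yv \<otimes>\<^bsub>R\<^esub> b)"
      using CP.Q_unit_or_multiple[of a] unfolding I a P.Units_iff[OF \<Phi>(2)] P.diff_kernel_iff[of a] P.hom_mult
      using P.closed by blast
  qed (rule P.closed)
  then show "\<exists>y. chain_gen R s y" by blast
  show "ring_char R = p ^ r"
    unfolding R.ring_char_eq_prime_power_iff[OF p r1(1)] hom_const_power[OF \<Phi>(1), symmetric] I[symmetric]
    using CP.Q_gens(1) CP.p_power_notin by blast
qed

theorem theorem3p1:
  fixes R :: "('a, 'b) ring_scheme" and p r s :: nat
  assumes "cring R" and "prime p" and "r \<ge> 2"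
  shows "(finite (carrier R) \<and> is_local_ring R \<and> is_PIR R \<and> ring_char R = p ^ r
            \<and> card (nontrivial_ideals R) = s)
     \<longleftrightarrow>
       (\<exists>(n::nat) (m::nat) (g :: nat \<Rightarrow> int) (u :: nat \<Rightarrow> nat \<Rightarrow> int) (v :: nat \<Rightarrow> nat \<Rightarrow> int)
          (t :: nat \<Rightarrow> nat) (e :: nat \<Rightarrow> nat).
          n \<ge> 1
        \<and> g \<in> carrier (ZX (p ^ r)) \<and> monicX (p ^ r) g
        \<and> (\<forall>i\<in>{1..n}. u i \<in> carrier (ZX (p ^ r)) - ideal_pg p r g)
        \<and> (\<forall>j\<in>{1..m}. v j \<in> carrier (ZX (p ^ r)) - ideal_pg p r g)
        \<and> ring_irreducible\<^bsub>ZX p\<^esub> (reduce_mod p g)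
        \<and> degX (p ^ r) g = degX p (reduce_mod p g)
        \<and> (\<forall>i\<in>{1..n}. degX (p ^ r) (u i) < degX (p ^ r) g)
        \<and> (\<forall>j\<in>{1..m}. degX (p ^ r) (v j) < degX (p ^ r) g)
        \<and> (\<forall>i\<in>{1..n}. 1 \<le> t i \<and> t i \<le> s) \<and> strict_mono_on {1..n} t
        \<and> (\<forall>j\<in>{1..m}. 1 \<le> e j \<and> e j \<le> s) \<and> strict_mono_on {1..m} e
        \<and> (r - 1) * t 1 \<le> s \<and> s < r * t 1
        \<and> R \<simeq> ZXY (p ^ r) Quot ideal_Q p r s n m g u v t e)"
    (is "?L \<longleftrightarrow> ?R")
proof
  assume L: ?L
  then obtain y where y: "chain_gen R s y"
    using cring.finite_local_PIR_iff_chain_gen[OF assms(1)] by blast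
  have fin: "finite (carrier R)" and char: "ring_char R = p ^ r" using L by blast+
  note p = \<open>prime p\<close> and r = \<open>r \<ge> 2\<close>
  interpret R: cring R by fact
  note D = R.chain_genD[OF y]
  have r1: "r \<ge> 1" "p dvd p ^ r" using r by (auto intro: dvd_power)
  have k: "p ^ r > 1" using one_less_power[OF prime_gt_1_nat[OF p], of r] r by simp
  obtain \<Phi> :: "int poly poly \<Rightarrow> 'a" where \<Phi>: "class_ring_hom R \<Phi>" "range \<Phi> = carrier R" "\<Phi> Yv = y"
    and monic: "\<exists>f. lead_coeff f = 1 \<and> \<Phi> [:f:] = \<zero>\<^bsub>R\<^esub>"
    using R.presenting_hom[OF fin y] by blast
  interpret P: class_ring_hom R \<Phi> by (rule \<Phi>(1))
  define I where "I = {a. \<Phi> a = \<zero>\<^bsub>R\<^esub>}"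
  have I: "a \<in> I \<longleftrightarrow> \<Phi> a = \<zero>\<^bsub>R\<^esub>" for a by (simp add: I_def)
  have char': "[(p ^ r)] \<cdot>\<^bsub>R\<^esub> \<one>\<^bsub>R\<^esub> = \<zero>\<^bsub>R\<^esub>" "[(p ^ (r - 1))] \<cdot>\<^bsub>R\<^esub> \<one>\<^bsub>R\<^esub> \<noteq> \<zero>\<^bsub>R\<^esub>"
    using R.ring_char_eq_prime_power_iff[OF p r1(1)] char by blast+
  interpret CI: chain_ideal I "int p" r s
  proof
    show "class_ideal I" unfolding I_def by (rule P.class_ideal_kernel)
    show "prime (int p)" using p by simp
    show "Yv ^ Suc s \<in> I" "Yv ^ s \<notin> I" unfolding I P.hom_power \<Phi>(3) using D(2,3) by blast+
    show "(\<exists>b. a * b - 1 \<in> I) \<or> (\<exists>b. a - Yv * b \<in> I)" for a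
    proof (cases "\<Phi> a \<in> Units R")
      case True
      then show ?thesis using P.Units_iff[OF \<Phi>(2)] unfolding I by blast
    next
      case False
      then obtain c where "c \<in> carrier R" "\<Phi> a = y \<otimes>\<^bsub>R\<^esub> c" using D(4)[of "\<Phi> a"] P.closed by blast
      then obtain b where "\<Phi> a = \<Phi> (Yv * b)" unfolding P.hom_mult \<Phi>(3) using \<Phi>(2) by (metis imageE)
      then show ?thesis unfolding I P.diff_kernel_iff by blast
    qed
    show "[:[:int p:]:] ^ r \<in> I" "[:[:int p:]:] ^ (r - 1) \<notin> I"
      unfolding I hom_const_power[OF \<Phi>(1)] using char' by blast+
    show "r \<ge> 2" by (rule r)
    show "\<exists>f. lead_coeff f = 1 \<and> [:f:] \<in> I" unfolding I by (rule monic)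
  qed
  obtain n m :: nat and g u v t e where n: "n \<ge> 1"
    and g: "lead_coeff g = 1" "irreducible_mod (int p) g" "degree g > 0"
    and u: "\<And>i. i \<in> {1..n} \<Longrightarrow> u i \<in> digits (int p) (degree g) \<and> u i \<notin> ideal_of [[:int p:], g]"
    and v: "\<And>j. j \<in> {1..m} \<Longrightarrow> v j \<in> digits (int p) (degree g) \<and> v j \<notin> ideal_of [[:int p:], g]"
    and t: "\<And>i. i \<in> {1..n} \<Longrightarrow> 1 \<le> t i \<and> t i \<le> s" "strict_mono_on {1..n} t"
    and e: "\<And>j. j \<in> {1..m} \<Longrightarrow> 1 \<le> e j \<and> e j \<le> s" "strict_mono_on {1..m} e"
    and bounds: "(r - 1) * t 1 \<le> s" "s < r * t 1"
    and IQ: "I = Q_ideal (int p) r s n m g u v t e"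
    by (rule CI.presentation) (rule that; (assumption | blast))
  let ?q = "redX (p ^ r)"
  interpret X: class_ring_hom "ZX (p ^ r)" ?q by (rule redX_hom[OF k])
  have deg: "degX (p ^ r) (?q g) = degree g" "monicX (p ^ r) (?q g)"
    using monic_redX[OF k g(1)] by blast+
  have redg: "reduce_mod p (?q g) = redX p g" by (rule reduce_mod_redX[OF r1(2)])
  have digit: "?q w \<in> carrier (ZX (p ^ r)) - ideal_pg p r (?q g)"
    "degX (p ^ r) (?q w) < degX (p ^ r) (?q g)"
    if w: "w \<in> digits (int p) (degree g) \<and> w \<notin> ideal_of [[:int p:], g]" for w
  proof -
    show "?q w \<in> carrier (ZX (p ^ r)) - ideal_pg p r (?q g)"
      using w redX_in_ideal_pg_iff[OF p r1(1)] X.closed by blast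
    show "degX (p ^ r) (?q w) < degX (p ^ r) (?q g)"
      unfolding deg using degX_redX_le[OF k, of w] digits_degree[of w "int p" "degree g"] w g(3)
      by (meson order_le_less_trans)
  qed
  note Q = redXY_in_ideal_Q_iff[OF p r1(1)]
  have iso: "R \<simeq> ZXY (p ^ r) Quot ideal_Q p r s n m (?q g) (\<lambda>i. ?q (u i)) (\<lambda>j. ?q (v j)) t e"
    unfolding iso_quotient_iff[OF \<open>cring R\<close> redXY_hom[OF k] range_redXY[OF k] Q(2)] Q(1) IQ[symmetric] I
    by (intro exI[of _ \<Phi>] conjI \<Phi> allI refl)
  have "ring_irreducible\<^bsub>ZX p\<^esub> (reduce_mod p (?q g))"
    unfolding redg using ring_irreducible_redX_iff[OF p] g(2) by blast
  moreover have "degX (p ^ r) (?q g) = degX p (reduce_mod p (?q g))"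
    unfolding redg deg using monic_redX[OF prime_gt_1_nat[OF p] g(1)] by simp
  ultimately show ?R
    using n X.closed deg(2) u v digit t e bounds iso
    by (intro exI[of _ n] exI[of _ m] exI[of _ "?q g"] exI[of _ "\<lambda>i. ?q (u i)"]
      exI[of _ "\<lambda>j. ?q (v j)"] exI[of _ t] exI[of _ e] conjI ballI) simp_all
next
  assume ?R
  then obtain n m g u v t e where n: "n \<ge> 1"
    and g: "g \<in> carrier (ZX (p ^ r))" "monicX (p ^ r) g" "ring_irreducible\<^bsub>ZX p\<^esub> (reduce_mod p g)"
    and u: "\<forall>i\<in>{1..n}. u i \<in> carrier (ZX (p ^ r)) - ideal_pg p r g"
    and v: "\<forall>j\<in>{1..m}. v j \<in> carrier (ZX (p ^ r)) - ideal_pg p r g"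
    and t: "\<forall>i\<in>{1..n}. 1 \<le> t i \<and> t i \<le> s" "strict_mono_on {1..n} t"
    and e: "\<forall>j\<in>{1..m}. 1 \<le> e j \<and> e j \<le> s"
    and bounds: "(r - 1) * t 1 \<le> s" "s < r * t 1"
    and iso: "R \<simeq> ZXY (p ^ r) Quot ideal_Q p r s n m g u v t e"
    by (elim exE conjE)
  have "finite (carrier R)" "\<exists>y. chain_gen R s y" "ring_char R = p ^ r"
    using presentation_imp_chain_ring[OF assms n g u _ t _ bounds iso] v e by blast+
  then show ?L using cring.finite_local_PIR_iff_chain_gen[OF assms(1)] by blast
qed

end
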